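(* Let $F$ be a field of characteristic $\neq 2$ and let $r\ge 0$, $s>0$ be integers. Let $\mathfrak{Z}(\mathfrak{K}_{r,s})$ denote the center of the Lie algebra $\mathfrak{K}_{r,s}$, and let $I$ be a multi-index. Then $e_I\in\mathfrak{Z}(\mathfrak{K}_{r,s})$ if and only if one of the following occurs: a) $e_I=\omega=e_1e_2\cdots e_{r+s}$, $r+s\equiv 1\pmod 4$ and $s$ is even; b) $I=\{r+1,r+2,\dots,r+s\}$ and $s\equiv 2\pmod 4$; c) $I=\{1,2,\dots,r\}$ and $r\equiv 1\pmod 4$.
   Context: Let $n=r+s$, let $e_1,\dots,e_n$ be the canonical basis of $F^n$, and let $Q$ be the symmetric bilinear form on $F^n$ with $Q(e_i,e_j)=0$ for $i\ne j$, $Q(e_i,e_i)=1$ for $1\le i\le r$, $Q(e_i,e_i)=-1$ for $r+1\le i\le r+s$. $C\ell(r,s)$ is the Clifford algebra over $F$ of $(F^n,Q)$, with sign convention $v\cdot v=-Q(v,v)1$; it is a Lie algebra with $[x,y]=xy-yx$. Let $c$ be the unique algebra anti-automorphism of $C\ell(r,s)$ with $c(v)=-v$ for $v\in F^n$, and let $\mathfrak{G}_{r,s}=\{\varphi\in C\ell(r,s):c(\varphi)=-\varphi\}$. Let $\beta$ be the algebra automorphism of $C\ell(r,s)$ with $\beta(e_i)=e_i$ for $1\le i\le r$ and $\beta(e_{r+j})=-e_{r+j}$ for $1\le j\le s$; it leaves $\mathfrak{G}_{r,s}$ invariant. $\mathfrak{K}_{r,s}$ is the $+1$ eigenspace of $\beta$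 restricted to $\mathfrak{G}_{r,s}$, a Lie subalgebra. A multi-index is a tuple $I=(i_1,\dots,i_k)$, $k\ge1$, with $1\le i_1<\dots<i_k\le n$, identified with the set of its entries, and $e_I=e_{i_1}\cdots e_{i_k}$. *)

theory Defs
  imports "HOL-Algebra.Algebra" "HOL-Library.Poly_Mapping"
begin

section \<open>The tensor algebra of \<open>F\<^sup>n\<close>\<close>

text \<open>
  \<open>Poly_Mapping\<close> provides the monoid algebra over any monoid that is written additively. Applied to
  the free monoid of words (with concatenation as \<open>+\<close>), it yields noncommutative polynomials;
  those in the letters \<open>1, \<dots>, n\<close> form the tensor algebra of \<open>F\<^sup>n\<close>, where the word
  \<open>[i\<^sub>1, \<dots>, i\<^sub>k]\<close> is \<open>e\<^bsub>i\<^sub>1\<^esub> \<otimes> \<dots> \<otimes> e\<^bsub>i\<^sub>k\<^esub>\<close>.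
\<close>

datatype word = Word (letters: "nat list")

instantiation word :: monoid_add
begin

definition zero_word :: word where
  "0 = Word []"

definition plus_word :: "word \<Rightarrow> word \<Rightarrow> word" where
  "u + v = Word (letters u @ letters v)"

instance
  by standard (auto simp: zero_word_def plus_word_def)

end

definition tensor_algebra :: "nat \<Rightarrow> (word \<Rightarrow>\<^sub>0 'f::field) ring" where
  "tensor_algebra n =
    \<lparr>carrier = {p. \<forall>w\<in>Poly_Mapping.keys p. set (letters w) \<subseteq> {1..n}},
     monoid.mult = (*), one = 1, ring.zero = 0, add = (+)\<rparr>"

text \<open>A vector of \<open>F\<^sup>n\<close> is a function \<open>v :: nat \<Rightarrow> 'f\<close>, of which only the
  coordinates \<open>v 1, \<dots>, v n\<close> are used.\<close>

definition tensor_vec :: "nat \<Rightarrow> (nat \<Rightarrow> 'f::field) \<Rightarrow> word \<Rightarrow>\<^sub>0 'f" where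
  "tensor_vec n v = (\<Sum>i=1..n. Poly_Mapping.single (Word [i]) (v i))"

definition tensor_scalar :: "'f::field \<Rightarrow> word \<Rightarrow>\<^sub>0 'f" where
  "tensor_scalar a = Poly_Mapping.single 0 a"

lemma tensor_algebra_ring: "ring (tensor_algebra n :: (word \<Rightarrow>\<^sub>0 'f::field) ring)"
proof (rule ringI)
  show "abelian_group (tensor_algebra n :: (word \<Rightarrow>\<^sub>0 'f::field) ring)"
  proof (rule abelian_groupI)
    fix x y :: "word \<Rightarrow>\<^sub>0 'f"
    assume "x \<in> carrier (tensor_algebra n)" "y \<in> carrier (tensor_algebra n)"
    then show "x \<oplus>\<^bsub>tensor_algebra n\<^esub> y \<in> carrier (tensor_algebra n)"
      using Poly_Mapping.keys_add[of x y] by (auto simp: tensor_algebra_def)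
  next
    fix x :: "word \<Rightarrow>\<^sub>0 'f"
    assume "x \<in> carrier (tensor_algebra n)"
    then show "\<exists>y\<in>carrier (tensor_algebra n). y \<oplus>\<^bsub>tensor_algebra n\<^esub> x = \<zero>\<^bsub>tensor_algebra n\<^esub>"
      by (intro bexI[of _ "- x"]) (auto simp: tensor_algebra_def)
  qed (auto simp: tensor_algebra_def add_ac)
  show "Group.monoid (tensor_algebra n :: (word \<Rightarrow>\<^sub>0 'f::field) ring)"
  proof (rule monoidI)
    fix x y :: "word \<Rightarrow>\<^sub>0 'f"
    assume "x \<in> carrier (tensor_algebra n)" "y \<in> carrier (tensor_algebra n)"
    then show "x \<otimes>\<^bsub>tensor_algebra n\<^esub> y \<in> carrier (tensor_algebra n)"
      using Poly_Mapping.keys_mult[of x y]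
      by (fastforce simp: tensor_algebra_def plus_word_def)
  qed (auto simp: tensor_algebra_def mult.assoc zero_word_def)
qed (auto simp: tensor_algebra_def algebra_simps)


section \<open>The Clifford algebra\<close>

definition bilin_form :: "nat \<Rightarrow> nat \<Rightarrow> (nat \<Rightarrow> 'f::field) \<Rightarrow> (nat \<Rightarrow> 'f) \<Rightarrow> 'f" where
  "bilin_form r s v w = (\<Sum>i=1..r. v i * w i) - (\<Sum>i=r+1..r+s. v i * w i)"

definition clifford_ideal :: "nat \<Rightarrow> nat \<Rightarrow> (word \<Rightarrow>\<^sub>0 'f::field) set" where
  "clifford_ideal r s = Idl\<^bsub>tensor_algebra (r + s)\<^esub>
     {tensor_vec (r + s) v * tensor_vec (r + s) v + tensor_scalar (bilin_form r s v v) | v. True}"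

definition clifford :: "nat \<Rightarrow> nat \<Rightarrow> (word \<Rightarrow>\<^sub>0 'f::field) set ring" where
  "clifford r s = tensor_algebra (r + s) Quot clifford_ideal r s"

definition cl_vec :: "nat \<Rightarrow> nat \<Rightarrow> (nat \<Rightarrow> 'f::field) \<Rightarrow> (word \<Rightarrow>\<^sub>0 'f) set" where
  "cl_vec r s v = clifford_ideal r s +>\<^bsub>tensor_algebra (r + s)\<^esub> tensor_vec (r + s) v"

definition cl_scalar :: "nat \<Rightarrow> nat \<Rightarrow> 'f::field \<Rightarrow> (word \<Rightarrow>\<^sub>0 'f) set" where
  "cl_scalar r s a = clifford_ideal r s +>\<^bsub>tensor_algebra (r + s)\<^esub> tensor_scalar a"

definition cl_basis :: "nat \<Rightarrow> nat \<Rightarrow> nat \<Rightarrow> (word \<Rightarrow>\<^sub>0 'f::field) set" where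
  "cl_basis r s i = cl_vec r s (\<lambda>j. if j = i then 1 else 0)"

text \<open>The product \<open>e\<^bsub>i\<^sub>1\<^esub> \<cdots> e\<^bsub>i\<^sub>k\<^esub>\<close> for the list \<open>[i\<^sub>1, \<dots>, i\<^sub>k]\<close>.\<close>

definition cl_monomial :: "nat \<Rightarrow> nat \<Rightarrow> nat list \<Rightarrow> (word \<Rightarrow>\<^sub>0 'f::field) set" where
  "cl_monomial r s I =
     foldr (\<lambda>i x. cl_basis r s i \<otimes>\<^bsub>clifford r s\<^esub> x) I \<one>\<^bsub>clifford r s\<^esub>"

definition cl_omega :: "nat \<Rightarrow> nat \<Rightarrow> (word \<Rightarrow>\<^sub>0 'f::field) set" where
  "cl_omega r s = cl_monomial r s [1..<r + s + 1]"

lemma clifford_ideal: "ideal (clifford_ideal r s :: (word \<Rightarrow>\<^sub>0 'f::field) set) (tensor_algebra (r + s))"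
proof -
  interpret ring "tensor_algebra (r + s) :: (word \<Rightarrow>\<^sub>0 'f) ring"
    by (rule tensor_algebra_ring)
  have v: "tensor_vec (r + s) v \<in> carrier (tensor_algebra (r + s))" for v :: "nat \<Rightarrow> 'f"
  proof -
    have "Poly_Mapping.keys (tensor_vec (r + s) v)
        \<subseteq> (\<Union>i\<in>{1..r+s}. Poly_Mapping.keys (Poly_Mapping.single (Word [i]) (v i)))"
      unfolding tensor_vec_def by (rule Poly_Mapping.keys_sum)
    then show ?thesis
      by (fastforce simp: tensor_algebra_def split: if_splits)
  qed
  have a: "tensor_scalar a \<in> carrier (tensor_algebra (r + s))" for a :: 'f
    by (auto simp: tensor_scalar_def tensor_algebra_def zero_word_def)
  have "x * x + y \<in> carrier (tensor_algebra (r + s))"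
    if "x \<in> carrier (tensor_algebra (r + s))" "y \<in> carrier (tensor_algebra (r + s))"
    for x y :: "word \<Rightarrow>\<^sub>0 'f"
    using a_closed[OF m_closed[OF that(1) that(1)] that(2)]
    by (simp add: tensor_algebra_def)
  then show ?thesis
    unfolding clifford_ideal_def by (intro genideal_ideal) (auto intro: v a)
qed

lemma clifford_ring: "ring (clifford r s :: (word \<Rightarrow>\<^sub>0 'f::field) set ring)"
  unfolding clifford_def by (rule ideal.quotient_is_ring[OF clifford_ideal])


section \<open>The involutions and the Lie algebras\<close>

definition opposite_ring :: "'a ring \<Rightarrow> 'a ring" where
  "opposite_ring R = R\<lparr>monoid.mult := \<lambda>x y. y \<otimes>\<^bsub>R\<^esub> x\<rparr>"

definition cl_linear ::
    "nat \<Rightarrow> nat \<Rightarrow> ((word \<Rightarrow>\<^sub>0 'f::field) set \<Rightarrow> (word \<Rightarrow>\<^sub>0 'f) set) \<Rightarrow> bool" where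
  "cl_linear r s f \<longleftrightarrow>
     (\<forall>x\<in>carrier (clifford r s). \<forall>y\<in>carrier (clifford r s).
        f (x \<oplus>\<^bsub>clifford r s\<^esub> y) = f x \<oplus>\<^bsub>clifford r s\<^esub> f y) \<and>
     (\<forall>a. \<forall>x\<in>carrier (clifford r s).
        f (cl_scalar r s a \<otimes>\<^bsub>clifford r s\<^esub> x) = cl_scalar r s a \<otimes>\<^bsub>clifford r s\<^esub> f x)"

text \<open>The maps below are determined only on the carrier, so that unique description requires
  that they be \<open>extensional\<close>.\<close>

definition cl_conj ::
    "nat \<Rightarrow> nat \<Rightarrow> (word \<Rightarrow>\<^sub>0 'f::field) set \<Rightarrow> (word \<Rightarrow>\<^sub>0 'f) set" where
  "cl_conj r s = (THE c.
     c \<in> extensional (carrier (clifford r s)) \<and>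
     c \<in> ring_iso (clifford r s) (opposite_ring (clifford r s)) \<and>
     cl_linear r s c \<and>
     (\<forall>v. c (cl_vec r s v) = \<ominus>\<^bsub>clifford r s\<^esub> cl_vec r s v))"

definition cl_beta ::
    "nat \<Rightarrow> nat \<Rightarrow> (word \<Rightarrow>\<^sub>0 'f::field) set \<Rightarrow> (word \<Rightarrow>\<^sub>0 'f) set" where
  "cl_beta r s = (THE b.
     b \<in> extensional (carrier (clifford r s)) \<and>
     b \<in> ring_iso (clifford r s) (clifford r s) \<and>
     cl_linear r s b \<and>
     (\<forall>i\<in>{1..r}. b (cl_basis r s i) = cl_basis r s i) \<and>
     (\<forall>j\<in>{1..s}. b (cl_basis r s (r + j)) = \<ominus>\<^bsub>clifford r s\<^esub> cl_basis r s (r + j)))"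

definition lie_G :: "nat \<Rightarrow> nat \<Rightarrow> (word \<Rightarrow>\<^sub>0 'f::field) set set" where
  "lie_G r s = {x \<in> carrier (clifford r s). cl_conj r s x = \<ominus>\<^bsub>clifford r s\<^esub> x}"

definition lie_K :: "nat \<Rightarrow> nat \<Rightarrow> (word \<Rightarrow>\<^sub>0 'f::field) set set" where
  "lie_K r s = {x \<in> lie_G r s. cl_beta r s x = x}"

definition lie_bracket :: "('a, 'b) ring_scheme \<Rightarrow> 'a \<Rightarrow> 'a \<Rightarrow> 'a" where
  "lie_bracket R x y = (x \<otimes>\<^bsub>R\<^esub> y) \<ominus>\<^bsub>R\<^esub> (y \<otimes>\<^bsub>R\<^esub> x)"

definition lie_center :: "('a, 'b) ring_scheme \<Rightarrow> 'a set \<Rightarrow> 'a set" where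
  "lie_center R L = {x \<in> L. \<forall>y\<in>L. lie_bracket R x y = \<zero>\<^bsub>R\<^esub>}"

end

(*
  Two monomials commute up to a sign: e_i e_I = (-1)^N e_I e_i, where N is the number of entries of I
  other than i. The conjugation multiplies e_I by (-1)^(k(k+1)/2), k = |I|, and beta by (-1)^m, where
  m is the number of entries of I above r. The Clifford algebra acts on the functions on sets of
  indices, hence it is nontrivial; as the monomials are units and 2 is invertible, all of these signs
  can be read off, without linear independence of the monomials. Testing a central e_I against e_i
  (i <= r) and against e_i e_j (i, j on the same side of r) leaves only the listed sets I. Conversely,
  in these cases e_I x = x e_I or e_I x = beta(x) e_I holds for all x, since it holds for generators.
*)
theory Submission
  imports Defs
begin

section \<open>Linear extension\<close>

text \<open>\<open>cl_conj\<close> and \<open>cl_beta\<close> are unique descriptions of maps on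
  cosets, so nothing can be computed with them before existence and uniqueness are settled. Both are
  therefore built on tensors, where they act word by word, and pushed down to the quotient.
  Identities in the Clifford algebra are likewise stated as equalities of \<open>cl_proj\<close>
  images, so that the arithmetic happens among tensors. The residues modulo 4: a monomial of length
  k lies in \<open>lie_G\<close> exactly when k(k+1)/2 is odd, that is, when k is 1 or 2 modulo 4.
  Testing against pairs makes I a union of the blocks 1..r and r+1..r+s; testing against e_1 makes k
  odd if the lower block is present and nonempty, and beta makes s even if the upper block is
  present. The relation twisted by beta gives centrality because beta fixes \<open>lie_K\<close>
  pointwise. Case a) speaks of the element omega, not of the set I. Centrality is proved for the
  word of omega and carried over by equality of elements, so no injectivity of the map from I to e_I
  enters.\<close>

definition lin_ext :: "('a \<Rightarrow> 'b::zero \<Rightarrow> 'c::comm_monoid_add) \<Rightarrow> ('a \<Rightarrow>\<^sub>0 'b) \<Rightarrow> 'c" where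
  "lin_ext h p = (\<Sum>w\<in>Poly_Mapping.keys p. h w (Poly_Mapping.lookup p w))"

lemma lin_ext_single:
  assumes "h w 0 = 0"
  shows "lin_ext h (Poly_Mapping.single w a) = h w a"
  using assms by (cases "a = 0") (auto simp: lin_ext_def)

lemma lin_ext_add:
  assumes zero: "\<And>w. h w 0 = 0" and add: "\<And>w a b. h w (a + b) = h w a + h w b"
  shows "lin_ext h (p + q) = lin_ext h p + lin_ext h q"
proof -
  let ?W = "Poly_Mapping.keys p \<union> Poly_Mapping.keys q"
  \<comment> \<open>The support of \<open>p + q\<close> may shrink by cancellation, so all three
    sums are taken over the common set \<open>?W\<close>; the extra terms are
    \<open>h w 0\<close>.\<close>
  have *: "lin_ext h u = (\<Sum>w\<in>?W. h w (Poly_Mapping.lookup u w))"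
    if "Poly_Mapping.keys u \<subseteq> ?W" for u
    unfolding lin_ext_def
    by (rule sum.mono_neutral_left) (use that zero in \<open>auto simp: in_keys_iff\<close>)
  show ?thesis
    using Poly_Mapping.keys_add[of p q]
    by (simp add: * lookup_add add sum.distrib)
qed

lemma update_eq_single_add:
  assumes "a \<notin> Poly_Mapping.keys f"
  shows "Poly_Mapping.update a b f = Poly_Mapping.single a b + f"
  using assms
  by (intro poly_mapping_eqI) (auto simp: lookup_update lookup_add lookup_single in_keys_iff)

text \<open>Reduces additive identities to single words; the zero polynomial is covered as a single
  word with coefficient 0.\<close>

lemma poly_mapping_single_add_induct [case_names single add]:
  assumes single: "\<And>a b. P (Poly_Mapping.single a b)"
    and add: "\<And>p q. P p \<Longrightarrow> P q \<Longrightarrow> P (p + q)"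
  shows "P p"
proof (induction p rule: update_induct)
  case const
  show ?case using single[of undefined 0] by simp
next
  case (update f a b)
  then show ?case using single add by (simp add: update_eq_single_add)
qed


section \<open>Monomials in the tensor algebra\<close>

abbreviation tensors :: "nat \<Rightarrow> (word \<Rightarrow>\<^sub>0 'f::field) set" where
  "tensors n \<equiv> carrier (tensor_algebra n)"

definition tmono :: "nat list \<Rightarrow> word \<Rightarrow>\<^sub>0 'f::field" where
  "tmono w = Poly_Mapping.single (Word w) 1"

lemma tmono_append: "tmono (u @ v) = tmono u * tmono v"
  by (simp add: tmono_def mult_single plus_word_def)

lemma tmono_Cons: "tmono (i # w) = tmono [i] * tmono w"
  using tmono_append[of "[i]" w] by simp

lemma tmono_Nil [simp]: "tmono [] = 1"
  by (simp add: tmono_def flip: single_one zero_word_def)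

lemma tensor_scalar_commute: "tensor_scalar a * p = p * tensor_scalar a"
proof (induction p rule: poly_mapping_single_add_induct)
  case (single w b)
  then show ?case
    by (cases w) (simp add: tensor_scalar_def mult_single mult.commute)
qed (simp add: algebra_simps)

lemma tensor_scalar_add: "tensor_scalar (a + b) = tensor_scalar a + tensor_scalar b"
  by (simp add: tensor_scalar_def single_add)

lemma tensor_scalar_uminus: "tensor_scalar (- a) = - tensor_scalar a"
  by (simp add: tensor_scalar_def single_uminus)

lemma tensor_scalar_mult: "tensor_scalar (a * b) = tensor_scalar a * tensor_scalar b"
  by (simp add: tensor_scalar_def mult_single)

lemma tensor_scalar_one: "tensor_scalar 1 = 1"
  by (simp add: tensor_scalar_def)

lemma minus_one_power_commute: "(-1) ^ m * p = p * (-1 :: 'a::ring_1) ^ m"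
  by (cases "even m") auto

lemma tensor_algebra_simps [simp]:
  "p \<otimes>\<^bsub>tensor_algebra n\<^esub> q = p * q"
  "p \<oplus>\<^bsub>tensor_algebra n\<^esub> q = p + q"
  "\<one>\<^bsub>tensor_algebra n\<^esub> = 1"
  "\<zero>\<^bsub>tensor_algebra n\<^esub> = 0"
  by (simp_all add: tensor_algebra_def)

lemma tensors_iff: "p \<in> tensors n \<longleftrightarrow> (\<forall>w\<in>Poly_Mapping.keys p. set (letters w) \<subseteq> {1..n})"
  by (simp add: tensor_algebra_def)

lemma tensors_add [intro, simp]: "p \<in> tensors n \<Longrightarrow> q \<in> tensors n \<Longrightarrow> p + q \<in> tensors n"
  using ring.ring_simprules(1)[OF tensor_algebra_ring, of p n q] by simp

lemma tensors_mult [intro, simp]: "p \<in> tensors n \<Longrightarrow> q \<in> tensors n \<Longrightarrow> p * q \<in> tensors n"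
  using ring.ring_simprules(5)[OF tensor_algebra_ring, of p n q] by simp

lemma tensors_uminus [intro, simp]: "p \<in> tensors n \<Longrightarrow> - p \<in> tensors n"
  by (simp add: tensors_iff)

lemma tensors_diff [intro, simp]: "p \<in> tensors n \<Longrightarrow> q \<in> tensors n \<Longrightarrow> p - q \<in> tensors n"
  using tensors_add[of p n "- q"] by simp

lemma tensors_zero [simp]: "0 \<in> tensors n"
  by (simp add: tensors_iff)

lemma tensors_one [simp]: "1 \<in> tensors n"
  by (simp add: tensors_iff zero_word_def)

lemma tensors_minus_one_power [simp]: "(-1) ^ m \<in> tensors n"
  by (cases "even m") auto

lemma tensors_scalar [simp]: "tensor_scalar a \<in> tensors n"
  by (simp add: tensors_iff tensor_scalar_def zero_word_def)

lemma tensors_mono [simp]: "set w \<subseteq> {1..n} \<Longrightarrow> tmono w \<in> tensors n"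
  by (simp add: tensors_iff tmono_def)

lemma tensors_sum:
  "(\<And>i. i \<in> A \<Longrightarrow> f i \<in> tensors n) \<Longrightarrow> sum f A \<in> tensors n"
  by (induction A rule: infinite_finite_induct) auto

lemma tensor_vec_eq: "tensor_vec n v = (\<Sum>i=1..n. tensor_scalar (v i) * tmono [i])"
  by (simp add: tensor_vec_def tensor_scalar_def tmono_def mult_single)

lemma tensors_vec [simp]: "tensor_vec n v \<in> tensors n"
  unfolding tensor_vec_eq by (auto intro!: tensors_sum)

lemma tensor_vec_basis:
  assumes "i \<in> {1..n}"
  shows "tensor_vec n (\<lambda>j. if j = i then 1 else 0) = tmono [i]"
proof -
  have "tensor_vec n (\<lambda>j. if j = i then 1 else 0) = (\<Sum>j=1..n. if j = i then tmono [j] else 0)"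
    unfolding tensor_vec_def by (rule sum.cong) (auto simp: tmono_def)
  also have "\<dots> = tmono [i]"
    using assms by simp
  finally show ?thesis .
qed

lemma tensor_vec_add: "tensor_vec n (\<lambda>j. u j + v j) = tensor_vec n u + tensor_vec n v"
  by (simp add: tensor_vec_def single_add sum.distrib)

text \<open>Induction over algebra generators that never leaves the letters \<open>1..n\<close>, as
  needed for relations that hold for those letters only.\<close>

lemma tensor_algebra_induct [consumes 1, case_names scalar basis add mult]:
  assumes p: "p \<in> tensors n"
    and scalar: "\<And>a. P (tensor_scalar a)"
    and basis: "\<And>i. i \<in> {1..n} \<Longrightarrow> P (tmono [i])"
    and add: "\<And>p q. p \<in> tensors n \<Longrightarrow> q \<in> tensors n \<Longrightarrow> P p \<Longrightarrow> P q \<Longrightarrow> P (p + q)"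
    and mult: "\<And>p q. p \<in> tensors n \<Longrightarrow> q \<in> tensors n \<Longrightarrow> P p \<Longrightarrow> P q \<Longrightarrow> P (p * q)"
  shows "P p"
proof -
  have tmono: "P (tmono w)" if "set w \<subseteq> {1..n}" for w
    using that
  proof (induction w)
    case Nil
    then show ?case using scalar[of 1] by (simp add: tensor_scalar_one)
  next
    case (Cons i w)
    then show ?case
      unfolding tmono_Cons[of i w] by (intro mult basis) auto
  qed
  have single: "P (Poly_Mapping.single w a)" if "set (letters w) \<subseteq> {1..n}" for w a
  proof -
    have "Poly_Mapping.single w a = tensor_scalar a * tmono (letters w)"
      by (simp add: tmono_def tensor_scalar_def mult_single)
    then show ?thesis using that by (simp add: mult scalar tmono)
  qed
  show ?thesis
    using p
  proof (induction p rule: update_induct)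
    case const
    show ?case using scalar[of 0] by (simp add: tensor_scalar_def)
  next
    case (update f a b)
    \<comment> \<open>The key is new and its coefficient nonzero, so nothing cancels and both
      summands stay in the carrier.\<close>
    then have "set (letters a) \<subseteq> {1..n}" "f \<in> tensors n"
      by (auto simp: tensors_iff keys_update split: if_splits)
    moreover from this have "Poly_Mapping.single a b \<in> tensors n"
      by (auto simp: tensors_iff split: if_splits)
    ultimately show ?case
      using update by (auto simp: update_eq_single_add intro!: add single)
  qed
qed


section \<open>Computing modulo the Clifford ideal\<close>

definition cl_proj :: "nat \<Rightarrow> nat \<Rightarrow> (word \<Rightarrow>\<^sub>0 'f::field) \<Rightarrow> (word \<Rightarrow>\<^sub>0 'f) set" where
  "cl_proj r s p = clifford_ideal r s +>\<^bsub>tensor_algebra (r + s)\<^esub> p"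

lemma cl_proj_hom: "ring_hom_ring (tensor_algebra (r + s)) (clifford r s) (cl_proj r s)"
  using ideal.rcos_ring_hom_ring[OF clifford_ideal[of r s]]
  by (simp add: cl_proj_def[abs_def] clifford_def)

lemma a_inv_tensor:
  assumes "p \<in> tensors n"
  shows "\<ominus>\<^bsub>tensor_algebra n\<^esub> p = - p"
proof -
  interpret ring "tensor_algebra n" by (rule tensor_algebra_ring)
  show ?thesis
    using minus_equality[of "- p" p] assms by simp
qed

lemma a_minus_tensor:
  assumes "p \<in> tensors n" "q \<in> tensors n"
  shows "p \<ominus>\<^bsub>tensor_algebra n\<^esub> q = p - q"
  using assms by (simp add: a_minus_def a_inv_tensor)

lemma
  assumes p: "p \<in> tensors (r + s)" and q: "q \<in> tensors (r + s)"
  shows cl_proj_mult: "cl_proj r s p \<otimes>\<^bsub>clifford r s\<^esub> cl_proj r s q = cl_proj r s (p * q)"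
    and cl_proj_add: "cl_proj r s p \<oplus>\<^bsub>clifford r s\<^esub> cl_proj r s q = cl_proj r s (p + q)"
    and cl_proj_diff: "cl_proj r s p \<ominus>\<^bsub>clifford r s\<^esub> cl_proj r s q = cl_proj r s (p - q)"
    and cl_proj_eq_iff: "cl_proj r s p = cl_proj r s q \<longleftrightarrow> p - q \<in> clifford_ideal r s"
proof -
  interpret ring_hom_ring "tensor_algebra (r + s)" "clifford r s" "cl_proj r s"
    by (rule cl_proj_hom)
  show "cl_proj r s p \<otimes>\<^bsub>clifford r s\<^esub> cl_proj r s q = cl_proj r s (p * q)"
    using hom_mult[OF p q] by simp
  show "cl_proj r s p \<oplus>\<^bsub>clifford r s\<^esub> cl_proj r s q = cl_proj r s (p + q)"
    using hom_add[OF p q] by simp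
  show "cl_proj r s p \<ominus>\<^bsub>clifford r s\<^esub> cl_proj r s q = cl_proj r s (p - q)"
    using hom_add[OF p, of "- q"] hom_a_inv[OF q] p q
    by (simp add: a_minus_def a_inv_tensor)
  show "cl_proj r s p = cl_proj r s q \<longleftrightarrow> p - q \<in> clifford_ideal r s"
    using R.quotient_eq_iff_same_a_r_cos[OF clifford_ideal p q]
    by (simp add: cl_proj_def a_minus_tensor p q)
qed

lemma cl_proj_uminus:
  assumes "p \<in> tensors (r + s)"
  shows "\<ominus>\<^bsub>clifford r s\<^esub> cl_proj r s p = cl_proj r s (- p)"
proof -
  interpret ring_hom_ring "tensor_algebra (r + s)" "clifford r s" "cl_proj r s"
    by (rule cl_proj_hom)
  show ?thesis
    using hom_a_inv[OF assms] assms by (simp add: a_inv_tensor)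
qed

lemma cl_proj_zero: "\<zero>\<^bsub>clifford r s\<^esub> = cl_proj r s 0"
  by (rule ring_hom_zero[OF ring_hom_ring.homh[OF cl_proj_hom] tensor_algebra_ring clifford_ring,
        symmetric, unfolded tensor_algebra_simps])

lemma cl_proj_one: "\<one>\<^bsub>clifford r s\<^esub> = cl_proj r s 1"
  by (rule ring_hom_one[OF ring_hom_ring.homh[OF cl_proj_hom], symmetric, unfolded tensor_algebra_simps])

lemma carrier_clifford: "carrier (clifford r s) = cl_proj r s ` tensors (r + s)"
  by (auto simp: clifford_def FactRing_def A_RCOSETS_def' cl_proj_def)

lemma cl_proj_closed [simp]: "p \<in> tensors (r + s) \<Longrightarrow> cl_proj r s p \<in> carrier (clifford r s)"
  by (simp add: carrier_clifford)

text \<open>The substitute for rewriting inside a product modulo the ideal.\<close>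

lemma cl_proj_mult_cong:
  assumes "cl_proj r s p = cl_proj r s p'" "cl_proj r s q = cl_proj r s q'"
    and "p \<in> tensors (r + s)" "p' \<in> tensors (r + s)" "q \<in> tensors (r + s)" "q' \<in> tensors (r + s)"
  shows "cl_proj r s (p * q) = cl_proj r s (p' * q')"
  using assms by (simp flip: cl_proj_mult)

lemma cl_proj_uminus_cong:
  assumes "cl_proj r s p = cl_proj r s p'" "p \<in> tensors (r + s)" "p' \<in> tensors (r + s)"
  shows "cl_proj r s (- p) = cl_proj r s (- p')"
  using assms by (simp flip: cl_proj_uminus)

lemma cl_vec_eq: "cl_vec r s v = cl_proj r s (tensor_vec (r + s) v)"
  by (simp add: cl_vec_def cl_proj_def)

lemma cl_scalar_eq: "cl_scalar r s a = cl_proj r s (tensor_scalar a)"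
  by (simp add: cl_scalar_def cl_proj_def)

lemma cl_basis_eq: "i \<in> {1..r + s} \<Longrightarrow> cl_basis r s i = cl_proj r s (tmono [i])"
  unfolding cl_basis_def cl_vec_eq by (subst tensor_vec_basis) simp_all

lemma cl_monomial_eq:
  assumes "set w \<subseteq> {1..r + s}"
  shows "cl_monomial r s w = (cl_proj r s (tmono w) :: (word \<Rightarrow>\<^sub>0 'f::field) set)"
  using assms
proof (induction w)
  case Nil
  then show ?case by (simp add: cl_monomial_def cl_proj_one)
next
  case (Cons i w)
  then have "cl_monomial r s (i # w) =
      (cl_proj r s (tmono [i]) \<otimes>\<^bsub>clifford r s\<^esub> cl_proj r s (tmono w) :: (word \<Rightarrow>\<^sub>0 'f) set)"
    by (simp add: cl_monomial_def cl_basis_eq)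
  also have "\<dots> = cl_proj r s (tmono (i # w))"
    using Cons.prems by (simp add: cl_proj_mult flip: tmono_Cons)
  finally show ?case .
qed

text \<open>The value Q(e_i, e_i), and at the same time the eigenvalue of beta on e_i.\<close>

definition q_sign :: "nat \<Rightarrow> nat \<Rightarrow> 'f::field" where
  "q_sign r i = (if i \<le> r then 1 else - 1)"

lemma q_sign_nonzero [simp]: "q_sign r i \<noteq> 0"
  by (simp add: q_sign_def)

lemma bilin_form_eq: "bilin_form r s v w = (\<Sum>i=1..r + s. q_sign r i * (v i * w i))"
proof -
  have "{1..r + s} = {1..r} \<union> {r + 1..r + s}"
    by auto
  then have "(\<Sum>i=1..r + s. q_sign r i * (v i * w i)) =
      (\<Sum>i=1..r. q_sign r i * (v i * w i)) + (\<Sum>i=r+1..r+s. q_sign r i * (v i * w i))"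
    by (simp add: sum.union_disjoint)
  also have "\<dots> = bilin_form r s v w"
    by (simp add: bilin_form_def q_sign_def sum_negf)
  finally show ?thesis ..
qed

section \<open>Closure properties of the Clifford ideal\<close>

lemma clifford_ideal_gens:
  "tensor_vec (r + s) v * tensor_vec (r + s) v + tensor_scalar (bilin_form r s v v)
    \<in> clifford_ideal r s"
proof -
  let ?S = "{tensor_vec (r + s) v * tensor_vec (r + s) v + tensor_scalar (bilin_form r s v v) | v. True}"
  have "?S \<subseteq> tensors (r + s)"
    by auto
  from ring.genideal_self[OF tensor_algebra_ring this] show ?thesis
    unfolding clifford_ideal_def by blast
qed

lemma clifford_ideal_minimal:
  assumes "ideal J (tensor_algebra (r + s))"
    and "\<And>v. tensor_vec (r + s) v * tensor_vec (r + s) v + tensor_scalar (bilin_form r s v v) \<in> J"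
  shows "clifford_ideal r s \<subseteq> J"
  unfolding clifford_ideal_def
  by (rule ring.genideal_minimal[OF tensor_algebra_ring]) (use assms in auto)

lemma clifford_ideal_subset: "clifford_ideal r s \<subseteq> tensors (r + s)"
  using additive_subgroup.a_subset[OF ideal.axioms(1)[OF clifford_ideal[of r s]]] .

lemma clifford_ideal_zero: "0 \<in> clifford_ideal r s"
  by (rule additive_subgroup.zero_closed[OF ideal.axioms(1)[OF clifford_ideal],
        unfolded tensor_algebra_simps])

lemma clifford_ideal_add:
  "p \<in> clifford_ideal r s \<Longrightarrow> q \<in> clifford_ideal r s \<Longrightarrow> p + q \<in> clifford_ideal r s"
  using additive_subgroup.a_closed[OF ideal.axioms(1)[OF clifford_ideal], of p r s q] by simp

lemma clifford_ideal_uminus: "p \<in> clifford_ideal r s \<Longrightarrow> - p \<in> clifford_ideal r s"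
  using additive_subgroup.a_inv_closed[OF ideal.axioms(1)[OF clifford_ideal], of p r s]
    clifford_ideal_subset[of r s]
  by (auto simp: a_inv_tensor tensor_algebra_ring ring.is_abelian_group)

lemma clifford_ideal_lmult:
  "p \<in> clifford_ideal r s \<Longrightarrow> q \<in> tensors (r + s) \<Longrightarrow> q * p \<in> clifford_ideal r s"
  using ideal.I_l_closed[OF clifford_ideal, of p r s q] by simp

lemma clifford_ideal_rmult:
  "p \<in> clifford_ideal r s \<Longrightarrow> q \<in> tensors (r + s) \<Longrightarrow> p * q \<in> clifford_ideal r s"
  using ideal.I_r_closed[OF clifford_ideal, of p r s q] by simp

lemma tensor_idealI:
  assumes subset: "J \<subseteq> tensors n" and zero_mem: "0 \<in> J"
    and add: "\<And>p q. p \<in> J \<Longrightarrow> q \<in> J \<Longrightarrow> p + q \<in> J"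
    and uminus: "\<And>p. p \<in> J \<Longrightarrow> - p \<in> J"
    and lmult: "\<And>p q. p \<in> J \<Longrightarrow> q \<in> tensors n \<Longrightarrow> q * p \<in> J"
    and rmult: "\<And>p q. p \<in> J \<Longrightarrow> q \<in> tensors n \<Longrightarrow> p * q \<in> J"
  shows "ideal J (tensor_algebra n)"
proof (rule idealI)
  interpret ring "tensor_algebra n" by (rule tensor_algebra_ring)
  show "subgroup J (add_monoid (tensor_algebra n))"
  proof (rule add.subgroupI)
    show "\<ominus>\<^bsub>tensor_algebra n\<^esub> p \<in> J" if "p \<in> J" for p
      using that subset uminus by (auto simp: a_inv_tensor subset_iff)
  qed (use subset zero_mem add in auto)
qed (use lmult rmult in \<open>auto intro: tensor_algebra_ring\<close>)

section \<open>Relations between basis vectors and the signs of reordering\<close>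

lemma cl_proj_basis_square:
  assumes i: "i \<in> {1..r + s}"
  shows "cl_proj r s (tmono [i] * tmono [i]) = cl_proj r s (tensor_scalar (- q_sign r i :: 'f::field))"
proof -
  let ?v = "\<lambda>j. if j = i then 1 else 0 :: 'f"
  have "bilin_form r s ?v ?v = (\<Sum>j=1..r + s. if j = i then q_sign r j else 0)"
    unfolding bilin_form_eq by (rule sum.cong) auto
  also have "\<dots> = q_sign r i"
    using i by simp
  finally show ?thesis
    using clifford_ideal_gens[of r s ?v] i
    by (simp add: cl_proj_eq_iff tensor_vec_basis[OF i] tensor_scalar_uminus)
qed

text \<open>Polarization: the relation for e_i + e_j minus those for e_i and e_j leaves the two
  mixed products.\<close>

lemma cl_proj_basis_anticommute:
  assumes i: "i \<in> {1..r + s}" and j: "j \<in> {1..r + s}" and ij: "i \<noteq> j"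
  shows "cl_proj r s (tmono [i] * tmono [j]) =
    cl_proj r s (- (tmono [j] * tmono [i] :: word \<Rightarrow>\<^sub>0 'f::field))"
proof -
  let ?e = "\<lambda>i j. if j = i then 1 else 0 :: 'f"
  let ?v = "\<lambda>k. ?e i k + ?e j k"
  have "bilin_form r s ?v ?v
      = (\<Sum>k=1..r + s. (if k = i then q_sign r k else 0) + (if k = j then q_sign r k else 0))"
    unfolding bilin_form_eq by (rule sum.cong) (use ij in auto)
  also have "\<dots> = q_sign r i + q_sign r j"
    using i j by (simp add: sum.distrib)
  finally have "(tmono [i] + tmono [j]) * (tmono [i] + tmono [j])
      + (tensor_scalar (q_sign r i) + tensor_scalar (q_sign r j))
      \<in> (clifford_ideal r s :: (word \<Rightarrow>\<^sub>0 'f) set)"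
    using clifford_ideal_gens[of r s ?v]
    by (simp add: tensor_vec_add tensor_vec_basis[OF i] tensor_vec_basis[OF j] tensor_scalar_add)
  note square = this
  have neg: "- (tmono [k] * tmono [k] + tensor_scalar (q_sign r k))
      \<in> (clifford_ideal r s :: (word \<Rightarrow>\<^sub>0 'f) set)"
    if "k \<in> {1..r + s}" for k
    using cl_proj_basis_square[OF that] that
    by (intro clifford_ideal_uminus) (simp add: cl_proj_eq_iff tensor_scalar_uminus)
  have "((tmono [i] + tmono [j]) * (tmono [i] + tmono [j])
      + (tensor_scalar (q_sign r i) + tensor_scalar (q_sign r j)))
      + (- (tmono [i] * tmono [i] + tensor_scalar (q_sign r i))
      + - (tmono [j] * tmono [j] + tensor_scalar (q_sign r j)))
      \<in> (clifford_ideal r s :: (word \<Rightarrow>\<^sub>0 'f) set)"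
    by (rule clifford_ideal_add[OF square clifford_ideal_add[OF neg[OF i] neg[OF j]]])
  also have "((tmono [i] + tmono [j]) * (tmono [i] + tmono [j])
      + (tensor_scalar (q_sign r i) + tensor_scalar (q_sign r j)))
      + (- (tmono [i] * tmono [i] + tensor_scalar (q_sign r i))
      + - (tmono [j] * tmono [j] + tensor_scalar (q_sign r j)))
      = tmono [i] * tmono [j] - (- (tmono [j] * tmono [i]))"
    by (simp add: algebra_simps)
  finally show ?thesis
    using i j by (simp add: cl_proj_eq_iff)
qed

text \<open>e_i passes the letters one at a time; each letter other than i costs a sign, a letter i
  costs none. Repeated letters are allowed.\<close>

lemma cl_proj_swap:
  assumes i: "i \<in> {1..r + s}" and w: "set w \<subseteq> {1..r + s}"
  shows "cl_proj r s (tmono [i] * tmono w)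
      = cl_proj r s ((-1) ^ length (filter (\<lambda>j. j \<noteq> i) w) *
          (tmono w * tmono [i] :: word \<Rightarrow>\<^sub>0 'f::field))"
  using w
proof (induction w)
  case Nil
  then show ?case by simp
next
  case (Cons j w)
  let ?N = "length (filter (\<lambda>j. j \<noteq> i) w)"
  have j: "j \<in> {1..r + s}" and w: "set w \<subseteq> {1..r + s}"
    using Cons.prems by auto
  have IH: "cl_proj r s (tmono [j] * (tmono [i] * tmono w))
      = cl_proj r s (tmono [j] * ((-1) ^ ?N * (tmono w * tmono [i] :: word \<Rightarrow>\<^sub>0 'f)))"
    by (rule cl_proj_mult_cong[OF refl Cons.IH[OF w]]) (use i j w in auto)
  have eq: "tmono [j] * ((-1) ^ ?N * (tmono w * tmono [i])) =
      (-1) ^ ?N * (tmono (j # w) * tmono [i] :: word \<Rightarrow>\<^sub>0 'f)"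
    by (simp only: tmono_Cons[of j w] mult.assoc minus_one_power_commute[of ?N])
  show ?case
  proof (cases "j = i")
    case True
    then show ?thesis
      using IH eq by (simp add: tmono_Cons[of i w])
  next
    case False
    have "cl_proj r s (tmono [i] * tmono (j # w)) =
        cl_proj r s ((tmono [i] * tmono [j]) * tmono w :: word \<Rightarrow>\<^sub>0 'f)"
      by (simp add: tmono_Cons[of j w] mult.assoc)
    also have "\<dots> = cl_proj r s (- (tmono [j] * tmono [i]) * tmono w)"
      by (rule cl_proj_mult_cong[OF cl_proj_basis_anticommute refl]) (use i j w False in auto)
    also have "\<dots> = cl_proj r s (- (tmono [j] * (tmono [i] * tmono w)))"
      by (simp add: mult.assoc)
    also have "\<dots> = cl_proj r s (- ((-1) ^ ?N * (tmono (j # w) * tmono [i])))"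
      unfolding eq[symmetric] by (intro cl_proj_uminus_cong IH) (use i j w in auto)
    finally show ?thesis
      using False by simp
  qed
qed

text \<open>Reversal interchanges every pair of letters once, and distinct letters
  anticommute.\<close>

lemma cl_proj_mono_rev:
  assumes "distinct w" "set w \<subseteq> {1..r + s}"
  shows "cl_proj r s (tmono (rev w)) =
    cl_proj r s ((-1) ^ (length w choose 2) * tmono w :: word \<Rightarrow>\<^sub>0 'f::field)"
  using assms
proof (induction w)
  case Nil
  then show ?case by (simp add: numeral_2_eq_2)
next
  case (Cons i w)
  let ?k = "length w" and ?m = "length w choose 2"
  have i: "i \<in> {1..r + s}" and w: "set w \<subseteq> {1..r + s}" and iw: "i \<notin> set w"
    using Cons.prems by auto
  have "filter (\<lambda>j. j \<noteq> i) w = w"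
    using iw by (auto intro: filter_True)
  then have swap: "cl_proj r s (tmono [i] * tmono w) = cl_proj r s ((-1) ^ ?k * (tmono w * tmono [i]))"
    using cl_proj_swap[OF i w] by simp
  have "cl_proj r s (tmono (rev (i # w))) = cl_proj r s (tmono (rev w) * tmono [i] :: word \<Rightarrow>\<^sub>0 'f)"
    by (simp add: tmono_append)
  also have "\<dots> = cl_proj r s ((-1) ^ ?m * tmono w * tmono [i])"
    by (rule cl_proj_mult_cong[OF Cons.IH refl]) (use Cons.prems in auto)
  \<comment> \<open>The sign \<open>(-1) ^ ?k\<close> is inserted twice, so that one copy is
    absorbed by \<open>swap\<close>.\<close>
  also have "\<dots> = cl_proj r s ((-1) ^ (?m + ?k) * ((-1) ^ ?k * (tmono w * tmono [i])))"
    by (simp add: power_add mult.assoc) (simp add: mult.assoc[symmetric] flip: power_add)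
  also have "\<dots> = cl_proj r s ((-1) ^ (?m + ?k) * (tmono [i] * tmono w))"
    by (rule cl_proj_mult_cong[OF refl swap[symmetric]]) (use i w in auto)
  also have "?m + ?k = length (i # w) choose 2"
    by (simp add: numeral_2_eq_2)
  finally show ?case
    by (simp add: tmono_Cons[of i w])
qed

text \<open>Equal letters meet in the middle and collapse to a nonzero scalar, pair after pair.
  Hence monomials can be cancelled.\<close>

lemma cl_proj_rev_mult:
  assumes "set w \<subseteq> {1..r + s}"
  shows "\<exists>c::'f::field. c \<noteq> 0 \<and> cl_proj r s (tmono (rev w) * tmono w) = cl_proj r s (tensor_scalar c)"
  using assms
proof (induction w)
  case Nil
  then show ?case by (intro exI[of _ 1]) (simp add: tensor_scalar_one)
next
  case (Cons i w)
  then obtain c :: 'f where c: "c \<noteq> 0"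
      "cl_proj r s (tmono (rev w) * tmono w) = cl_proj r s (tensor_scalar c)"
    by auto
  let ?q = "- q_sign r i :: 'f"
  have "cl_proj r s (tmono (rev (i # w)) * tmono (i # w))
      = cl_proj r s (tmono (rev w) * (tmono [i] * tmono [i]) * tmono w)"
    by (simp add: tmono_append tmono_Cons[of i w] mult.assoc)
  also have "\<dots> = cl_proj r s (tmono (rev w) * tensor_scalar ?q * tmono w)"
    by (rule cl_proj_mult_cong[OF cl_proj_mult_cong[OF refl cl_proj_basis_square] refl]) (use Cons.prems in auto)
  also have "\<dots> = cl_proj r s (tensor_scalar ?q * (tmono (rev w) * tmono w))"
    by (simp only: tensor_scalar_commute[symmetric] mult.assoc)
  also have "\<dots> = cl_proj r s (tensor_scalar ?q * tensor_scalar c)"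
    by (rule cl_proj_mult_cong[OF refl c(2)]) (use Cons.prems in auto)
  finally show ?case
    using c(1) by (intro exI[of _ "?q * c"] conjI) (simp, simp only: tensor_scalar_mult)
qed


section \<open>Nontriviality of the Clifford algebra\<close>

text \<open>Symmetric difference with \<open>{i}\<close>: the product of e_i and e_A is a multiple
  of the monomial of \<open>flip i A\<close>.\<close>

definition flip :: "nat \<Rightarrow> nat set \<Rightarrow> nat set" where
  "flip i A = (if i \<in> A then A - {i} else insert i A)"

lemma flip_mem: "k \<in> flip i A \<longleftrightarrow> (if k = i then i \<notin> A else k \<in> A)"
  by (auto simp: flip_def)

lemma flip_flip [simp]: "flip i (flip i A) = A"
  by (auto simp: flip_mem split: if_splits)

lemma flip_commute: "flip i (flip k A) = flip k (flip i A)"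
  by (auto simp: flip_mem split: if_splits)

lemma sign_flip_ge:
  assumes "k \<le> i"
  shows "card {j \<in> flip i A. j < k} = card {j \<in> A. j < k}"
  by (rule arg_cong[of _ _ card]) (use assms in \<open>auto simp: flip_mem\<close>)

text \<open>Toggling an index below k changes the count by one, whereas toggling one at or above k
  does not. This asymmetry is the source of anticommutation.\<close>

lemma sign_flip_less:
  assumes "i < k"
  shows "(-1) ^ card {j \<in> flip i A. j < k} = - ((-1) ^ card {j \<in> A. j < k} :: 'a::ring_1)"
proof -
  have *: "(-1) ^ card {j \<in> B. j < k} = - ((-1) ^ card {j \<in> B - {i}. j < k} :: 'a)"
    if "i \<in> B" for B
  proof -
    have "{j \<in> B. j < k} = insert i {j \<in> B - {i}. j < k}"
      using that assms by auto
    then show ?thesis by simp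
  qed
  show ?thesis
    using *[of A] *[of "insert i A"] by (cases "i \<in> A") (simp_all add: flip_def)
qed

text \<open>If \<open>f\<close> lists the coordinates of \<open>\<Sum> f(A) e\<^sub>A\<close>, then \<open>basis_act r i\<close> is left multiplication by
  \<open>e\<^sub>i\<close>.\<close>

definition basis_act :: "nat \<Rightarrow> nat \<Rightarrow> (nat set \<Rightarrow> 'f::field) \<Rightarrow> nat set \<Rightarrow> 'f" where
  "basis_act r i f A =
     (-1) ^ card {j \<in> A. j < i} * (if i \<in> A then 1 else - q_sign r i) * f (flip i A)"

lemma basis_act_square: "basis_act r i (basis_act r i f) A = - q_sign r i * f A"
proof -
  have "((-1) ^ m * ((-1) ^ m * x)) = (x :: 'f::field)" for m x
    by (cases "even m") auto
  then show ?thesis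
    by (simp add: basis_act_def sign_flip_ge flip_mem[of i i] mult.assoc mult.left_commute)
qed

lemma basis_act_anticommute:
  assumes "i \<noteq> k"
  shows "basis_act r i (basis_act r k f) A + basis_act r k (basis_act r i f) A = 0"
proof -
  \<comment> \<open>For \<open>i < k\<close> the sign of e_k sees the toggled i, but the sign of e_i
    does not see the toggled k; so the two orders differ by exactly one sign.\<close>
  have *: "basis_act r i (basis_act r k f) A + basis_act r k (basis_act r i f) A = 0"
    if "i < k" for i k
    using that
    by (simp add: basis_act_def sign_flip_ge sign_flip_less flip_mem[of i k] flip_mem[of k i] flip_commute[of i k])
  show ?thesis
    using *[of i k] *[of k i] assms by (cases "i < k") (auto simp: add.commute)
qed

lemma basis_act_add: "basis_act r i (\<lambda>A. f A + g A) = (\<lambda>A. basis_act r i f A + basis_act r i g A)"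
  by (simp add: basis_act_def fun_eq_iff algebra_simps)

lemma basis_act_scale: "basis_act r i (\<lambda>A. c * f A) = (\<lambda>A. c * basis_act r i f A)"
  by (simp add: basis_act_def fun_eq_iff)

lemma basis_act_sum:
  "basis_act r i (\<lambda>A. \<Sum>k\<in>K. f k A) A = (\<Sum>k\<in>K. basis_act r i (f k) A)"
  by (simp add: basis_act_def sum_distrib_left)

definition word_act :: "nat \<Rightarrow> nat list \<Rightarrow> (nat set \<Rightarrow> 'f::field) \<Rightarrow> nat set \<Rightarrow> 'f" where
  "word_act r w f = foldr (basis_act r) w f"

lemma word_act_add: "word_act r w (\<lambda>A. f A + g A) = (\<lambda>A. word_act r w f A + word_act r w g A)"
  by (induction w) (simp_all add: word_act_def basis_act_add)

lemma word_act_scale: "word_act r w (\<lambda>A. c * f A) = (\<lambda>A. c * word_act r w f A)"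
  by (induction w) (simp_all add: word_act_def basis_act_scale)

lemma word_act_zero: "word_act r w (\<lambda>_. 0) = (\<lambda>_. 0)"
  by (induction w) (simp_all add: word_act_def basis_act_def)

text \<open>The representation of the tensor algebra in which letters act by
  \<open>basis_act\<close>. Infinite sets do no harm, since the signs count only the indices below a
  given one.\<close>

definition tensor_act ::
    "nat \<Rightarrow> (word \<Rightarrow>\<^sub>0 'f::field) \<Rightarrow> (nat set \<Rightarrow> 'f) \<Rightarrow> nat set \<Rightarrow> 'f" where
  "tensor_act r p f A = lin_ext (\<lambda>w a. a * word_act r (letters w) f A) p"

lemma tensor_act_single:
  "tensor_act r (Poly_Mapping.single w a) f = (\<lambda>A. a * word_act r (letters w) f A)"
  by (simp add: tensor_act_def lin_ext_single fun_eq_iff)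

lemma tensor_act_add: "tensor_act r (p + q) f = (\<lambda>A. tensor_act r p f A + tensor_act r q f A)"
  by (simp add: tensor_act_def lin_ext_add distrib_right fun_eq_iff)

lemma tensor_act_mult: "tensor_act r (p * q) f = tensor_act r p (tensor_act r q f)"
proof (induction p rule: poly_mapping_single_add_induct)
  case (single u a)
  show ?case
  proof (induction q rule: poly_mapping_single_add_induct)
    case (single v b)
    show ?case
      by (simp add: mult_single tensor_act_single word_act_scale plus_word_def mult.assoc)
        (simp add: word_act_def)
  next
    case (add q q')
    then show ?case
      by (simp add: tensor_act_add distrib_left tensor_act_single word_act_add)
  qed
next
  case (add p p')
  then show ?case by (simp add: tensor_act_add distrib_right)
qed

lemma tensor_act_zero [simp]: "tensor_act r 0 f A = 0"
  by (simp add: tensor_act_def lin_ext_def)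

lemma tensor_act_zero_right: "tensor_act r p (\<lambda>_. 0) A = 0"
  by (induction p rule: poly_mapping_single_add_induct)
    (simp_all add: tensor_act_add tensor_act_single word_act_zero)

lemma tensor_act_uminus: "tensor_act r (- p) f A = - tensor_act r p f A"
  using tensor_act_add[of r p "- p" f] by (simp add: fun_eq_iff eq_neg_iff_add_eq_0 add.commute)

lemma tensor_act_scalar: "tensor_act r (tensor_scalar a) f A = a * f A"
  by (simp add: tensor_scalar_def tensor_act_single word_act_def zero_word_def)

lemma tensor_act_vec:
  "tensor_act r (tensor_vec n v) f A = (\<Sum>i=1..n. v i * basis_act r i f A)"
proof -
  have "tensor_act r (\<Sum>i\<in>K. Poly_Mapping.single (Word [i]) (v i)) f A
      = (\<Sum>i\<in>K. v i * basis_act r i f A)" for K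
    by (induction K rule: infinite_finite_induct)
      (simp_all add: tensor_act_add tensor_act_single word_act_def)
  then show ?thesis by (simp add: tensor_vec_def)
qed

text \<open>Row and column of each new index cancel against each other. Nothing is divided by 2, so
  this is valid in every characteristic.\<close>

lemma sum_antisymmetric_off_diagonal:
  fixes a :: "'a \<Rightarrow> 'a \<Rightarrow> 'b::ab_group_add"
  assumes "finite K" "\<And>i k. i \<in> K \<Longrightarrow> k \<in> K \<Longrightarrow> i \<noteq> k \<Longrightarrow> a i k + a k i = 0"
  shows "(\<Sum>i\<in>K. \<Sum>k\<in>K. a i k) = (\<Sum>i\<in>K. a i i)"
  using assms
proof (induction K)
  case empty
  then show ?case by simp
next
  case (insert x K)
  have "(\<Sum>k\<in>K. a x k) + (\<Sum>i\<in>K. a i x) = (\<Sum>k\<in>K. a x k + a k x)"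
    by (simp add: sum.distrib)
  also have "\<dots> = 0"
    using insert by (intro sum.neutral) auto
  finally have *: "(\<Sum>k\<in>K. a x k) + (\<Sum>i\<in>K. a i x) = 0" .
  have "(\<Sum>i\<in>insert x K. \<Sum>k\<in>insert x K. a i k)
      = a x x + ((\<Sum>k\<in>K. a x k) + (\<Sum>i\<in>K. a i x)) + (\<Sum>i\<in>K. \<Sum>k\<in>K. a i k)"
    using insert(1,2) by (simp add: sum.distrib algebra_simps)
  also have "\<dots> = a x x + (\<Sum>i\<in>K. a i i)"
    using * insert by simp
  finally show ?case
    using insert(1,2) by simp
qed

lemma tensor_act_square:
  "tensor_act r (tensor_vec (r + s) v * tensor_vec (r + s) v) f A = - bilin_form r s v v * f A"
proof -
  have "tensor_act r (tensor_vec (r + s) v * tensor_vec (r + s) v) f A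
      = (\<Sum>i=1..r + s. v i * basis_act r i (\<lambda>A. \<Sum>k=1..r + s. v k * basis_act r k f A) A)"
    by (simp add: tensor_act_mult tensor_act_vec[abs_def])
  also have "\<dots> = (\<Sum>i=1..r + s. \<Sum>k=1..r + s. v i * v k * basis_act r i (basis_act r k f) A)"
    by (simp add: basis_act_sum basis_act_scale sum_distrib_left mult.assoc)
  also have "\<dots> = (\<Sum>i=1..r + s. v i * v i * basis_act r i (basis_act r i f) A)"
  proof (rule sum_antisymmetric_off_diagonal)
    fix i k :: nat assume "i \<noteq> k"
    then show "v i * v k * basis_act r i (basis_act r k f) A
        + v k * v i * basis_act r k (basis_act r i f) A = 0"
      using basis_act_anticommute[of i k r f A] by (simp add: mult.commute[of "v k" "v i"] flip: distrib_left)
  qed simp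
  also have "\<dots> = - bilin_form r s v v * f A"
    by (simp add: basis_act_square bilin_form_eq sum_distrib_left sum_distrib_right mult_ac
        flip: sum_negf)
  finally show ?thesis .
qed

text \<open>The kernel of the representation is an ideal that contains the generators, so the action
  descends to the Clifford algebra.\<close>

lemma tensor_act_clifford_ideal:
  fixes p :: "word \<Rightarrow>\<^sub>0 'f::field"
  assumes "p \<in> clifford_ideal r s"
  shows "tensor_act r p f A = 0"
proof -
  let ?K = "{p :: word \<Rightarrow>\<^sub>0 'f. p \<in> tensors (r + s) \<and> (\<forall>f A. tensor_act r p f A = 0)}"
  have "ideal ?K (tensor_algebra (r + s))"
  proof (rule tensor_idealI)
    fix p q :: "word \<Rightarrow>\<^sub>0 'f"
    assume p: "p \<in> ?K" and q: "q \<in> tensors (r + s)"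
    then have "tensor_act r p f = (\<lambda>_. 0)" for f
      by (simp add: fun_eq_iff)
    then show "q * p \<in> ?K" "p * q \<in> ?K"
      using p q by (simp_all add: tensor_act_mult tensor_act_zero_right)
  qed (auto simp: tensor_act_add tensor_act_uminus)
  then have "clifford_ideal r s \<subseteq> ?K"
    by (rule clifford_ideal_minimal) (simp add: tensor_act_add tensor_act_square tensor_act_scalar)
  with assms show ?thesis by blast
qed

section \<open>Reading off scalars and signs\<close>

lemma cl_proj_scalar_eq_zero:
  assumes "cl_proj r s (tensor_scalar a) = cl_proj r s 0"
  shows "a = 0"
proof -
  have "tensor_scalar a \<in> clifford_ideal r s"
    using assms by (simp add: cl_proj_eq_iff)
  \<comment> \<open>A scalar acts by multiplication, so its action on the constant function 1
    returns the scalar itself.\<close>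
  then show ?thesis
    using tensor_act_clifford_ideal[of "tensor_scalar a" r s "\<lambda>_. 1" "{}"]
    by (simp add: tensor_act_scalar)
qed

text \<open>Multiplying by the reversed word turns the monomial into a nonzero scalar, and scalars
  embed.\<close>

lemma cl_proj_mono_eq_zero:
  fixes a :: "'f::field"
  assumes w: "set w \<subseteq> {1..r + s}" and eq: "cl_proj r s (tensor_scalar a * tmono w) = cl_proj r s 0"
  shows "a = 0"
proof -
  obtain c :: 'f where c: "c \<noteq> 0" "cl_proj r s (tmono (rev w) * tmono w) = cl_proj r s (tensor_scalar c)"
    using cl_proj_rev_mult[OF w] by blast
  have "cl_proj r s (tensor_scalar (a * c)) = cl_proj r s (tensor_scalar a * (tmono (rev w) * tmono w))"
    unfolding tensor_scalar_mult by (rule cl_proj_mult_cong[OF refl c(2)[symmetric]]) (use w in auto)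
  also have "\<dots> = cl_proj r s (tmono (rev w) * (tensor_scalar a * tmono w))"
    by (simp only: mult.assoc[symmetric] tensor_scalar_commute[of a "tmono (rev w)"])
  also have "\<dots> = cl_proj r s (tmono (rev w) * 0)"
    by (rule cl_proj_mult_cong[OF refl eq]) (use w in auto)
  finally have "a * c = 0"
    by (intro cl_proj_scalar_eq_zero) simp
  with c(1) show ?thesis by simp
qed

text \<open>For odd m the equality says that twice the monomial vanishes, so 2 = 0 in the field.
  Words with repeated letters are included, since this is also applied to a concatenation of two
  monomials.\<close>

lemma cl_proj_sign_mono_eq_iff:
  assumes char: "CHAR('f::field) \<noteq> 2" and w: "set w \<subseteq> {1..r + s}"
  shows "cl_proj r s ((-1) ^ m * tmono w) = cl_proj r s (tmono w :: word \<Rightarrow>\<^sub>0 'f) \<longleftrightarrow> even m"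
proof
  assume eq: "cl_proj r s ((-1) ^ m * tmono w) = cl_proj r s (tmono w :: word \<Rightarrow>\<^sub>0 'f)"
  show "even m"
  proof (rule ccontr)
    assume "odd m"
    with eq w have "tmono w - - tmono w \<in> (clifford_ideal r s :: (word \<Rightarrow>\<^sub>0 'f) set)"
      by (subst cl_proj_eq_iff[symmetric]) auto
    also have "tmono w - - tmono w = tensor_scalar 2 * tmono w - (0 :: word \<Rightarrow>\<^sub>0 'f)"
      using tensor_scalar_add[of 1 "1 :: 'f"] by (simp add: tensor_scalar_one mult_2)
    finally have "cl_proj r s (tensor_scalar (2 :: 'f) * tmono w) = cl_proj r s 0"
      using w by (subst cl_proj_eq_iff) auto
    then have "of_nat 2 = (0 :: 'f)"
      using cl_proj_mono_eq_zero[OF w] by simp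
    \<comment> \<open>A characteristic dividing 2 is neither 0 nor, in a field, 1; it would have to
      be 2.\<close>
    then have "CHAR('f) dvd 2"
      by (simp only: of_nat_eq_0_iff_char_dvd)
    then have "CHAR('f) \<le> 2" "CHAR('f) \<noteq> 0"
      by (auto dest: dvd_imp_le intro!: gr0I)
    moreover have "CHAR('f) \<noteq> 1"
      by simp
    ultimately show False using char by linarith
  qed
qed simp


lemma cl_proj_sign_mono_eq_uminus_iff:
  assumes char: "CHAR('f::field) \<noteq> 2" and w: "set w \<subseteq> {1..r + s}"
  shows "cl_proj r s ((-1) ^ m * tmono w) = cl_proj r s (- tmono w :: word \<Rightarrow>\<^sub>0 'f) \<longleftrightarrow> odd m"
  using cl_proj_sign_mono_eq_iff[OF assms, of 1] by (cases "even m") auto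


section \<open>The conjugation and the automorphism \<open>\<beta>\<close>\<close>

text \<open>The map \<open>t\<close> preserves the Clifford ideal, so taking images of cosets is the induced map on the
  quotient.\<close>

locale tensor_involution =
  fixes r s :: nat and t :: "(word \<Rightarrow>\<^sub>0 'f::field) \<Rightarrow> (word \<Rightarrow>\<^sub>0 'f)" and anti :: bool
  assumes t_add: "t (p + q) = t p + t q"
    and t_mult: "t (p * q) = (if anti then t q * t p else t p * t q)"
    and t_scalar: "t (tensor_scalar a) = tensor_scalar a"
    and t_t: "t (t p) = p"
    and t_vec_closed: "t (tensor_vec n v) \<in> tensors n"
    and t_gens: "t (tensor_vec (r + s) v * tensor_vec (r + s) v + tensor_scalar (bilin_form r s v v))
      \<in> clifford_ideal r s"
begin

text \<open>An anti-automorphism is a homomorphism into the opposite ring, which has the same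
  carrier and sum; this lets one argument serve both maps.\<close>

definition target :: "(word \<Rightarrow>\<^sub>0 'f) set ring" where
  "target = (if anti then opposite_ring (clifford r s) else clifford r s)"

definition lift :: "(word \<Rightarrow>\<^sub>0 'f) set \<Rightarrow> (word \<Rightarrow>\<^sub>0 'f) set" where
  "lift = restrict ((`) t) (carrier (clifford r s))"

lemma lift_extensional: "lift \<in> extensional (carrier (clifford r s))"
  by (simp add: lift_def)

lemma t_zero: "t 0 = 0"
  using t_scalar[of 0] by (simp add: tensor_scalar_def)

lemma t_one: "t 1 = 1"
  using t_scalar[of 1] by (simp add: tensor_scalar_one)

lemma t_uminus: "t (- p) = - t p"
  using t_add[of p "- p"] by (simp add: t_zero eq_neg_iff_add_eq_0 add.commute)

lemma t_closed: "p \<in> tensors n \<Longrightarrow> t p \<in> tensors n"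
proof (induction p rule: tensor_algebra_induct)
  case (basis i)
  then show ?case using t_vec_closed[of n "\<lambda>j. if j = i then 1 else 0"] by (simp only: tensor_vec_basis)
qed (simp_all add: t_scalar t_add t_mult)

text \<open>The preimage of the ideal under \<open>t\<close> is again an ideal, also when
  \<open>t\<close> reverses products, and it contains the generators.\<close>

lemma t_clifford_ideal: "p \<in> clifford_ideal r s \<Longrightarrow> t p \<in> clifford_ideal r s"
proof -
  let ?J = "{p \<in> tensors (r + s). t p \<in> clifford_ideal r s}"
  have "ideal ?J (tensor_algebra (r + s))"
    by (rule tensor_idealI)
      (auto simp: t_zero t_add t_uminus t_mult t_closed
        intro: clifford_ideal_zero clifford_ideal_add clifford_ideal_uminus
          clifford_ideal_lmult clifford_ideal_rmult)
  then have "clifford_ideal r s \<subseteq> ?J"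
    by (rule clifford_ideal_minimal) (use t_gens in auto)
  then show "p \<in> clifford_ideal r s \<Longrightarrow> t p \<in> clifford_ideal r s"
    by blast
qed

lemma lift_cl_proj:
  assumes "p \<in> tensors (r + s)"
  shows "lift (cl_proj r s p) = cl_proj r s (t p)"
proof -
  have "t ` cl_proj r s p = (\<lambda>h. t h + t p) ` clifford_ideal r s"
    by (auto simp: cl_proj_def a_r_coset_def' t_add image_iff)
  also have "\<dots> = (\<lambda>h. h + t p) ` t ` clifford_ideal r s"
    by (simp add: image_image)
  \<comment> \<open>As \<open>t\<close> is its own inverse, it maps the ideal onto itself; hence the
    image of a coset is a full coset.\<close>
  also have "t ` clifford_ideal r s = clifford_ideal r s"
    using t_clifford_ideal t_t by (auto simp: image_iff) metis
  also have "(\<lambda>h. h + t p) ` clifford_ideal r s = cl_proj r s (t p)"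
    by (auto simp: cl_proj_def a_r_coset_def')
  finally show ?thesis
    using assms by (simp add: lift_def)
qed

lemma lift_iso: "lift \<in> ring_iso (clifford r s) target"
proof -
  have "lift \<in> ring_hom (clifford r s) target"
    by (rule ring_hom_memI)
      (auto simp: carrier_clifford target_def opposite_ring_def cl_proj_mult cl_proj_add cl_proj_one
        lift_cl_proj t_closed t_mult t_add t_one)
  moreover have "bij_betw lift (carrier (clifford r s)) (carrier (clifford r s))"
    by (rule bij_betw_byWitness[where f' = lift])
      (auto simp: carrier_clifford lift_cl_proj t_closed t_t)
  ultimately show ?thesis
    by (simp add: ring_iso_def target_def opposite_ring_def)
qed

lemma lift_linear: "cl_linear r s lift"
  unfolding cl_linear_def
  by (auto simp: carrier_clifford cl_scalar_eq cl_proj_mult cl_proj_add lift_cl_proj t_closed t_mult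
      t_add t_scalar tensor_scalar_commute)

lemma lift_unique:
  assumes ext: "f \<in> extensional (carrier (clifford r s))"
    and hom: "f \<in> ring_hom (clifford r s) target"
    and linear: "cl_linear r s f"
    and basis: "\<And>i. i \<in> {1..r + s} \<Longrightarrow> f (cl_basis r s i) = lift (cl_basis r s i)"
  shows "f = lift"
proof (rule extensionalityI[OF ext lift_extensional])
  have lift_hom: "lift \<in> ring_hom (clifford r s) target"
    using lift_iso by (simp add: ring_iso_def)
  fix x :: "(word \<Rightarrow>\<^sub>0 'f) set"
  assume "x \<in> carrier (clifford r s)"
  then obtain p where x: "x = cl_proj r s p" and p: "p \<in> tensors (r + s)"
    by (auto simp: carrier_clifford)
  from p show "f x = lift x"
    unfolding x
  proof (induction p rule: tensor_algebra_induct)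
    case (scalar a)
    \<comment> \<open>Field scalars are not reached through the basis vectors: linearity reduces
      them to the unit, whose image is forced.\<close>
    have *: "g (cl_proj r s (tensor_scalar a)) = cl_proj r s (tensor_scalar a) \<otimes>\<^bsub>clifford r s\<^esub> \<one>\<^bsub>target\<^esub>"
      if "cl_linear r s g" "g \<in> ring_hom (clifford r s) target" for g
    proof -
      have "cl_proj r s (tensor_scalar a)
          = cl_scalar r s a \<otimes>\<^bsub>clifford r s\<^esub> (\<one>\<^bsub>clifford r s\<^esub> :: (word \<Rightarrow>\<^sub>0 'f) set)"
        by (simp add: cl_scalar_eq cl_proj_one cl_proj_mult)
      moreover have "\<one>\<^bsub>clifford r s\<^esub> \<in> carrier (clifford r s :: (word \<Rightarrow>\<^sub>0 'f) set ring)"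
        by (simp add: cl_proj_one)
      ultimately show ?thesis
        using that ring_hom_one[OF that(2)] by (simp add: cl_linear_def) (simp add: cl_scalar_eq)
    qed
    show ?case
      by (simp add: *[OF linear hom] *[OF lift_linear lift_hom])
  next
    case (basis i)
    then show ?case using assms(4)[of i] by (simp add: cl_basis_eq)
  next
    case (add p q)
    then show ?case
      using ring_hom_add[OF hom, of "cl_proj r s p" "cl_proj r s q"]
        ring_hom_add[OF lift_hom, of "cl_proj r s p" "cl_proj r s q"]
      by (simp add: cl_proj_add)
  next
    case (mult p q)
    then show ?case
      using ring_hom_mult[OF hom, of "cl_proj r s p" "cl_proj r s q"]
        ring_hom_mult[OF lift_hom, of "cl_proj r s p" "cl_proj r s q"]
      by (simp add: cl_proj_mult)
  qed
qed

end

text \<open>The anti-automorphism of the tensor algebra that extends negation of vectors.\<close>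

definition tensor_conj :: "(word \<Rightarrow>\<^sub>0 'f::field) \<Rightarrow> (word \<Rightarrow>\<^sub>0 'f)" where
  "tensor_conj = lin_ext (\<lambda>w a.
     Poly_Mapping.single (Word (rev (letters w))) ((-1) ^ length (letters w) * a))"

text \<open>The automorphism of the tensor algebra that multiplies e_i by
  \<open>q_sign r i\<close>.\<close>

definition tensor_beta :: "nat \<Rightarrow> (word \<Rightarrow>\<^sub>0 'f::field) \<Rightarrow> (word \<Rightarrow>\<^sub>0 'f)" where
  "tensor_beta r = lin_ext (\<lambda>w a.
     Poly_Mapping.single w ((-1) ^ length (filter (\<lambda>i. r < i) (letters w)) * a))"

lemma tensor_conj_single:
  "tensor_conj (Poly_Mapping.single w a) =
     Poly_Mapping.single (Word (rev (letters w))) ((-1) ^ length (letters w) * a)"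
  by (simp add: tensor_conj_def lin_ext_single)

lemma tensor_beta_single:
  "tensor_beta r (Poly_Mapping.single w a) =
     Poly_Mapping.single w ((-1) ^ length (filter (\<lambda>i. r < i) (letters w)) * a)"
  by (simp add: tensor_beta_def lin_ext_single)

lemma tensor_conj_add: "tensor_conj (p + q) = tensor_conj p + tensor_conj q"
  by (simp add: tensor_conj_def lin_ext_add single_add distrib_left)

lemma tensor_beta_add: "tensor_beta r (p + q) = tensor_beta r p + tensor_beta r q"
  by (simp add: tensor_beta_def lin_ext_add single_add distrib_left)

lemma tensor_conj_mult: "tensor_conj (p * q) = tensor_conj q * tensor_conj p"
proof (induction p rule: poly_mapping_single_add_induct)
  case (single u a)
  show ?case
    by (induction q rule: poly_mapping_single_add_induct)
      (simp_all add: mult_single tensor_conj_single plus_word_def power_add mult_ac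
        distrib_left distrib_right tensor_conj_add)
qed (simp add: distrib_left distrib_right tensor_conj_add)

lemma tensor_beta_mult: "tensor_beta r (p * q) = tensor_beta r p * tensor_beta r q"
proof (induction p rule: poly_mapping_single_add_induct)
  case (single u a)
  show ?case
    by (induction q rule: poly_mapping_single_add_induct)
      (simp_all add: mult_single tensor_beta_single plus_word_def power_add mult_ac
        distrib_left tensor_beta_add)
qed (simp add: distrib_right tensor_beta_add)

lemma tensor_conj_scalar: "tensor_conj (tensor_scalar a) = tensor_scalar a"
  by (simp add: tensor_scalar_def tensor_conj_single zero_word_def)

lemma tensor_beta_scalar: "tensor_beta r (tensor_scalar a) = tensor_scalar a"
  by (simp add: tensor_scalar_def tensor_beta_single zero_word_def)

lemma tensor_conj_mono: "tensor_conj (tmono w) = (-1) ^ length w * tmono (rev w)"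
  by (cases "even (length w)") (simp_all add: tmono_def tensor_conj_single single_uminus)

lemma tensor_beta_mono: "tensor_beta r (tmono w) = (-1) ^ length (filter (\<lambda>i. r < i) w) * tmono w"
  by (cases "even (length (filter (\<lambda>i. r < i) w))")
    (simp_all add: tmono_def tensor_beta_single single_uminus)

lemma sign_sign: "(-1) ^ m * ((-1) ^ m * a) = (a :: 'a::ring_1)"
  by (cases "even m") auto

lemma tensor_conj_conj: "tensor_conj (tensor_conj p) = p"
  by (induction p rule: poly_mapping_single_add_induct)
    (simp_all add: tensor_conj_single tensor_conj_add sign_sign)

lemma tensor_beta_beta: "tensor_beta r (tensor_beta r p) = p"
  by (induction p rule: poly_mapping_single_add_induct)
    (simp_all add: tensor_beta_single tensor_beta_add sign_sign)

lemma tensor_conj_vec: "tensor_conj (tensor_vec n v) = - tensor_vec n v"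
proof -
  have "tensor_conj (\<Sum>i\<in>K. Poly_Mapping.single (Word [i]) (v i))
      = - (\<Sum>i\<in>K. Poly_Mapping.single (Word [i]) (v i))" for K
    by (induction K rule: infinite_finite_induct)
      (use tensor_conj_scalar[of 0] in
        \<open>simp_all add: tensor_scalar_def tensor_conj_add tensor_conj_single single_uminus\<close>)
  then show ?thesis by (simp add: tensor_vec_def)
qed

lemma tensor_beta_vec: "tensor_beta r (tensor_vec n v) = tensor_vec n (\<lambda>i. q_sign r i * v i)"
proof -
  have "tensor_beta r (\<Sum>i\<in>K. Poly_Mapping.single (Word [i]) (v i))
      = (\<Sum>i\<in>K. Poly_Mapping.single (Word [i]) (q_sign r i * v i))" for K
    by (induction K rule: infinite_finite_induct)
      (use tensor_beta_scalar[of r 0] in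
        \<open>simp_all add: tensor_scalar_def tensor_beta_add tensor_beta_single q_sign_def\<close>)
  then show ?thesis by (simp add: tensor_vec_def)
qed

text \<open>Each generator of the ideal is fixed, since (-v)(-v) = vv.\<close>

interpretation conj: tensor_involution r s tensor_conj True for r s
  by standard
    (simp_all add: tensor_conj_add tensor_conj_mult tensor_conj_scalar tensor_conj_conj
      tensor_conj_vec clifford_ideal_gens)

text \<open>Changing signs of coordinates is an isometry, so the generator of v goes to the
  generator of the reflected vector \<open>?u\<close>.\<close>

interpretation beta: tensor_involution r s "tensor_beta r" False for r s
proof
  fix v :: "nat \<Rightarrow> 'a"
  let ?u = "\<lambda>i. q_sign r i * v i"
  have "q_sign r i * (?u i * ?u i) = q_sign r i * (v i * v i)" for i
    by (simp add: q_sign_def)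
  then have "bilin_form r s ?u ?u = bilin_form r s v v"
    by (simp only: bilin_form_eq)
  then show "tensor_beta r (tensor_vec (r + s) v * tensor_vec (r + s) v
      + tensor_scalar (bilin_form r s v v)) \<in> clifford_ideal r s"
    using clifford_ideal_gens[of r s ?u]
    by (simp add: tensor_beta_add tensor_beta_mult tensor_beta_scalar tensor_beta_vec)
qed (simp_all add: tensor_beta_add tensor_beta_mult tensor_beta_scalar tensor_beta_beta
    tensor_beta_vec)

text \<open>Resolves the unique description: \<open>conj.lift\<close> has the required properties,
  and agreement on basis vectors forces equality.\<close>

lemma cl_conj_cl_proj:
  fixes p :: "word \<Rightarrow>\<^sub>0 'f::field"
  assumes "p \<in> tensors (r + s)"
  shows "cl_conj r s (cl_proj r s p) = cl_proj r s (tensor_conj p)"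
proof -
  have vec: "conj.lift r s (cl_vec r s v) = \<ominus>\<^bsub>clifford r s\<^esub> cl_vec r s v" for v :: "nat \<Rightarrow> 'f"
    by (simp add: cl_vec_eq conj.lift_cl_proj tensor_conj_vec cl_proj_uminus)
  have "(cl_conj r s :: (word \<Rightarrow>\<^sub>0 'f) set \<Rightarrow> _) = conj.lift r s"
    unfolding cl_conj_def
  proof (rule the_equality)
    show "conj.lift r s \<in> extensional (carrier (clifford r s)) \<and>
        conj.lift r s \<in> ring_iso (clifford r s) (opposite_ring (clifford r s)) \<and>
        cl_linear r s (conj.lift r s) \<and>
        (\<forall>v :: nat \<Rightarrow> 'f. conj.lift r s (cl_vec r s v) = \<ominus>\<^bsub>clifford r s\<^esub> cl_vec r s v)"
      by (intro conjI allI conj.lift_extensional conj.lift_linear vec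
          conj.lift_iso[unfolded conj.target_def if_True])
  next
    fix c :: "(word \<Rightarrow>\<^sub>0 'f) set \<Rightarrow> _"
    assume "c \<in> extensional (carrier (clifford r s)) \<and>
        c \<in> ring_iso (clifford r s) (opposite_ring (clifford r s)) \<and>
        cl_linear r s c \<and>
        (\<forall>v. c (cl_vec r s v) = \<ominus>\<^bsub>clifford r s\<^esub> cl_vec r s v)"
    then show "c = conj.lift r s"
      by (intro conj.lift_unique)
        (auto simp: conj.target_def ring_iso_def cl_basis_def vec)
  qed
  then show ?thesis
    using assms by (simp add: conj.lift_cl_proj)
qed

lemma cl_beta_cl_proj:
  fixes p :: "word \<Rightarrow>\<^sub>0 'f::field"
  assumes "p \<in> tensors (r + s)"
  shows "cl_beta r s (cl_proj r s p) = cl_proj r s (tensor_beta r p)"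
proof -
  have pos: "beta.lift r s (cl_basis r s i) = (cl_basis r s i :: (word \<Rightarrow>\<^sub>0 'f) set)"
    if "i \<in> {1..r}" for i
    using that by (simp add: cl_basis_eq beta.lift_cl_proj tensor_beta_mono)
  have neg: "beta.lift r s (cl_basis r s (r + j)) =
      \<ominus>\<^bsub>clifford r s\<^esub> (cl_basis r s (r + j) :: (word \<Rightarrow>\<^sub>0 'f) set)"
    if "j \<in> {1..s}" for j
    using that by (simp add: cl_basis_eq beta.lift_cl_proj tensor_beta_mono cl_proj_uminus)
  have "(cl_beta r s :: (word \<Rightarrow>\<^sub>0 'f) set \<Rightarrow> _) = beta.lift r s"
    unfolding cl_beta_def
  proof (rule the_equality)
    show "beta.lift r s \<in> extensional (carrier (clifford r s)) \<and>
        beta.lift r s \<in> ring_iso (clifford r s) (clifford r s) \<and>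
        cl_linear r s (beta.lift r s) \<and>
        (\<forall>i\<in>{1..r}. beta.lift r s (cl_basis r s i) = (cl_basis r s i :: (word \<Rightarrow>\<^sub>0 'f) set)) \<and>
        (\<forall>j\<in>{1..s}. beta.lift r s (cl_basis r s (r + j)) =
          \<ominus>\<^bsub>clifford r s\<^esub> (cl_basis r s (r + j) :: (word \<Rightarrow>\<^sub>0 'f) set))"
      by (intro conjI ballI beta.lift_extensional beta.lift_linear pos neg
          beta.lift_iso[unfolded beta.target_def if_False])
  next
    fix b :: "(word \<Rightarrow>\<^sub>0 'f) set \<Rightarrow> _"
    assume b: "b \<in> extensional (carrier (clifford r s)) \<and>
        b \<in> ring_iso (clifford r s) (clifford r s) \<and>
        cl_linear r s b \<and>
        (\<forall>i\<in>{1..r}. b (cl_basis r s i) = cl_basis r s i) \<and>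
        (\<forall>j\<in>{1..s}. b (cl_basis r s (r + j)) = \<ominus>\<^bsub>clifford r s\<^esub> cl_basis r s (r + j))"
    have "b (cl_basis r s i) = beta.lift r s (cl_basis r s i)" if i: "i \<in> {1..r + s}" for i
    proof (cases "i \<le> r")
      case True
      then show ?thesis using b i pos by simp
    next
      case False
      then have "i - r \<in> {1..s}" "i = r + (i - r)"
        using i by auto
      then show ?thesis using b neg by metis
    qed
    then show "b = beta.lift r s"
      using b by (intro beta.lift_unique) (auto simp: beta.target_def ring_iso_def)
  qed
  then show ?thesis
    using assms by (simp add: beta.lift_cl_proj)
qed



section \<open>The center\<close>

lemma cl_proj_mem_lie_K_iff:
  assumes "p \<in> tensors (r + s)"
  shows "cl_proj r s p \<in> lie_K r s \<longleftrightarrow>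
    cl_proj r s (tensor_conj p) = cl_proj r s (- p) \<and> cl_proj r s (tensor_beta r p) = cl_proj r s p"
  using assms
  by (simp add: lie_K_def lie_G_def cl_conj_cl_proj cl_beta_cl_proj cl_proj_uminus)

text \<open>This is the triangular number k(k+1)/2; its parity has period 4, because four
  consecutive integers have an even sum.\<close>

lemma odd_Suc_choose_two_iff: "odd (Suc k choose 2) \<longleftrightarrow> k mod 4 = 1 \<or> k mod 4 = 2"
proof (induction k)
  case 0
  then show ?case by (simp add: numeral_2_eq_2)
next
  case (Suc k)
  have "Suc (Suc k) choose 2 = Suc k + (Suc k choose 2)"
    by (simp add: numeral_2_eq_2)
  with Suc.IH show ?case by presburger
qed

lemma mono_mem_lie_K_iff:
  assumes char: "CHAR('f::field) \<noteq> 2" and dist: "distinct w" and w: "set w \<subseteq> {1..r + s}"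
  shows "cl_proj r s (tmono w :: word \<Rightarrow>\<^sub>0 'f) \<in> lie_K r s \<longleftrightarrow>
    (length w mod 4 = 1 \<or> length w mod 4 = 2) \<and> even (length (filter (\<lambda>i. r < i) w))"
proof -
  let ?k = "length w" and ?w = "tmono w :: word \<Rightarrow>\<^sub>0 'f"
  have "cl_proj r s (tensor_conj ?w) = cl_proj r s ((-1) ^ ?k * ((-1) ^ (?k choose 2) * ?w))"
    unfolding tensor_conj_mono
    by (rule cl_proj_mult_cong[OF refl cl_proj_mono_rev[OF dist w]]) (use w in auto)
  \<comment> \<open>The k signs from negating the letters join those from reversing the word, by
    Pascal's rule.\<close>
  also have "(-1) ^ ?k * ((-1) ^ (?k choose 2) * ?w) = (-1) ^ (Suc ?k choose 2) * ?w"
    by (simp add: numeral_2_eq_2 power_add mult.assoc)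
  finally have "cl_proj r s (tensor_conj ?w) = cl_proj r s (- ?w) \<longleftrightarrow> odd (Suc ?k choose 2)"
    using cl_proj_sign_mono_eq_uminus_iff[OF char w] by simp
  moreover have "cl_proj r s (tensor_beta r ?w) = cl_proj r s ?w \<longleftrightarrow>
      even (length (filter (\<lambda>i. r < i) w))"
    unfolding tensor_beta_mono by (rule cl_proj_sign_mono_eq_iff[OF char w])
  ultimately show ?thesis
    using w by (simp only: cl_proj_mem_lie_K_iff tensors_mono odd_Suc_choose_two_iff)
qed

section \<open>Commutation with monomials\<close>

lemma lie_bracket_cl_proj_eq_zero_iff:
  assumes "p \<in> tensors (r + s)" "q \<in> tensors (r + s)"
  shows "lie_bracket (clifford r s) (cl_proj r s p) (cl_proj r s q) = \<zero>\<^bsub>clifford r s\<^esub> \<longleftrightarrow>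
    cl_proj r s (p * q) = cl_proj r s (q * p)"
  using assms
  by (simp add: lie_bracket_def cl_proj_mult cl_proj_diff cl_proj_zero cl_proj_eq_iff)

text \<open>Twisted commutation passes through sums and products, so generators decide. It is
  applied with \<open>t\<close> the identity and with \<open>t\<close> equal to
  \<open>tensor_beta r\<close>.\<close>

lemma cl_proj_intertwine:
  assumes m: "m \<in> tensors (r + s)" and p: "p \<in> tensors (r + s)"
    and closed: "\<And>p. p \<in> tensors (r + s) \<Longrightarrow> t p \<in> tensors (r + s)"
    and t_add: "\<And>p q. t (p + q) = t p + t q" and t_mult: "\<And>p q. t (p * q) = t p * t q"
    and t_scalar: "\<And>a. t (tensor_scalar a) = tensor_scalar a"
    and basis: "\<And>i. i \<in> {1..r + s} \<Longrightarrow>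
      cl_proj r s (m * tmono [i]) = cl_proj r s (t (tmono [i]) * m)"
  shows "cl_proj r s (m * p) = cl_proj r s (t p * m)"
  using p
proof (induction p rule: tensor_algebra_induct)
  case (scalar a)
  then show ?case by (simp add: t_scalar tensor_scalar_commute)
next
  case (basis i)
  then show ?case by (rule assms)
next
  case (add p q)
  then show ?case
    using m by (simp add: t_add distrib_left distrib_right closed flip: cl_proj_add)
next
  case (mult p q)
  have "cl_proj r s (m * (p * q)) = cl_proj r s ((m * p) * q)"
    by (simp add: mult.assoc)
  also have "\<dots> = cl_proj r s ((t p * m) * q)"
    by (rule cl_proj_mult_cong[OF mult.IH(1) refl]) (use mult m closed in auto)
  also have "\<dots> = cl_proj r s (t p * (m * q))"
    by (simp add: mult.assoc)
  also have "\<dots> = cl_proj r s (t p * (t q * m))"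
    by (rule cl_proj_mult_cong[OF refl mult.IH(2)]) (use mult m closed in auto)
  finally show ?case
    by (simp add: t_mult mult.assoc)
qed

lemma length_filter_neq:
  assumes "distinct w"
  shows "length (filter (\<lambda>j. j \<noteq> i) w) = (if i \<in> set w then length w - 1 else length w)"
  using assms by (induction w) (auto dest: length_pos_if_in_set)

text \<open>Under the first parity condition the monomial commutes with the whole algebra. Under the
  second, moving x past it turns x into beta(x), which is x again for x in
  \<open>lie_K\<close>.\<close>

lemma mono_mem_lie_center:
  fixes w :: "nat list"
  assumes K: "cl_proj r s (tmono w :: word \<Rightarrow>\<^sub>0 'f::field) \<in> lie_K r s"
    and w: "set w \<subseteq> {1..r + s}"
    and parity: "(\<forall>i\<in>{1..r + s}. even (length (filter (\<lambda>j. j \<noteq> i) w))) \<or>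
      (\<forall>i\<in>{1..r + s}. even (length (filter (\<lambda>j. j \<noteq> i) w)) \<longleftrightarrow> i \<le> r)"
  shows "cl_proj r s (tmono w :: word \<Rightarrow>\<^sub>0 'f) \<in> lie_center (clifford r s) (lie_K r s)"
proof -
  let ?w = "tmono w :: word \<Rightarrow>\<^sub>0 'f"
  note swap = cl_proj_swap[OF _ w, where ?'f = 'f]
  have "lie_bracket (clifford r s) (cl_proj r s ?w) y = \<zero>\<^bsub>clifford r s\<^esub>"
    if y: "y \<in> lie_K r s" for y
  proof -
    obtain p where y_eq: "y = cl_proj r s p" and p: "p \<in> tensors (r + s)"
      using y by (auto simp: lie_K_def lie_G_def carrier_clifford)
    have beta: "cl_proj r s (tensor_beta r p) = cl_proj r s p"
      using y p by (simp add: y_eq cl_proj_mem_lie_K_iff)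
    have "cl_proj r s (?w * p) = cl_proj r s (p * ?w)"
      using parity
    proof
      assume even: "\<forall>i\<in>{1..r + s}. even (length (filter (\<lambda>j. j \<noteq> i) w))"
      show ?thesis
        by (rule cl_proj_intertwine[where t = "\<lambda>p. p"]) (use even w p in \<open>simp_all add: swap\<close>)
    next
      assume even: "\<forall>i\<in>{1..r + s}. even (length (filter (\<lambda>j. j \<noteq> i) w)) \<longleftrightarrow> i \<le> r"
      have "cl_proj r s (?w * p) = cl_proj r s (tensor_beta r p * ?w)"
      proof (rule cl_proj_intertwine)
        fix i assume i: "i \<in> {1..r + s}"
        have "cl_proj r s (- (tmono [i] * ?w)) = cl_proj r s (- (- (?w * tmono [i])))" if "\<not> i \<le> r"
          by (rule cl_proj_uminus_cong) (use swap[OF i] even i w that in auto)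
        then show "cl_proj r s (?w * tmono [i]) = cl_proj r s (tensor_beta r (tmono [i]) * ?w)"
          using swap[OF i] even i by (auto simp: tensor_beta_mono)
      qed (use w p in \<open>simp_all add: beta.t_closed tensor_beta_add tensor_beta_mult tensor_beta_scalar\<close>)
      also have "\<dots> = cl_proj r s (p * ?w)"
        by (rule cl_proj_mult_cong[OF beta refl]) (use w p in \<open>auto simp: beta.t_closed\<close>)
      finally show ?thesis .
    qed
    then show ?thesis
      using w p by (simp add: y_eq lie_bracket_cl_proj_eq_zero_iff)
  qed
  with K show ?thesis by (simp add: lie_center_def)
qed

lemma mono_mem_lie_center_commute:
  assumes char: "CHAR('f::field) \<noteq> 2"
    and center: "cl_proj r s (tmono w :: word \<Rightarrow>\<^sub>0 'f) \<in> lie_center (clifford r s) (lie_K r s)"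
    and v: "cl_proj r s (tmono v :: word \<Rightarrow>\<^sub>0 'f) \<in> lie_K r s"
    and ws: "set w \<subseteq> {1..r + s}" and vs: "set v \<subseteq> {1..r + s}"
  shows "even (\<Sum>i\<leftarrow>v. length (filter (\<lambda>j. j \<noteq> i) w))"
proof -
  let ?N = "\<lambda>v. \<Sum>i\<leftarrow>v. length (filter (\<lambda>j. j \<noteq> i) w)"
  have swap: "cl_proj r s (tmono v * tmono w) = cl_proj r s ((-1) ^ ?N v * (tmono w * tmono v :: word \<Rightarrow>\<^sub>0 'f))"
    using vs
  proof (induction v)
    case Nil
    then show ?case by simp
  next
    case (Cons i v)
    let ?n = "length (filter (\<lambda>j. j \<noteq> i) w)"
    have i: "i \<in> {1..r + s}" and v: "set v \<subseteq> {1..r + s}"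
      using Cons.prems by auto
    have "cl_proj r s (tmono (i # v) * tmono w) =
        cl_proj r s (tmono [i] * (tmono v * tmono w) :: word \<Rightarrow>\<^sub>0 'f)"
      by (simp add: tmono_Cons[of i v] mult.assoc)
    also have "\<dots> = cl_proj r s (tmono [i] * ((-1) ^ ?N v * (tmono w * tmono v)))"
      by (rule cl_proj_mult_cong[OF refl Cons.IH[OF v]]) (use i v ws in auto)
    also have "\<dots> = cl_proj r s ((tmono [i] * tmono w) * ((-1) ^ ?N v * tmono v))"
      by (simp only: mult.assoc minus_one_power_commute[of "?N v"])
    also have "\<dots> = cl_proj r s (((-1) ^ ?n * (tmono w * tmono [i])) * ((-1) ^ ?N v * tmono v))"
      by (rule cl_proj_mult_cong[OF cl_proj_swap[OF i ws] refl]) (use i v ws in auto)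
    also have "((-1) ^ ?n * (tmono w * tmono [i])) * ((-1) ^ ?N v * tmono v)
        = (-1) ^ ?N (i # v) * (tmono w * tmono (i # v) :: word \<Rightarrow>\<^sub>0 'f)"
      by (cases "even (?N v)"; cases "even ?n") (simp_all add: tmono_Cons[of i v] mult.assoc)
    finally show ?case .
  qed
  have "cl_proj r s (tmono w * tmono v :: word \<Rightarrow>\<^sub>0 'f) = cl_proj r s (tmono v * tmono w)"
    using center v ws vs
    by (subst lie_bracket_cl_proj_eq_zero_iff[symmetric]) (auto simp: lie_center_def)
  \<comment> \<open>Both products become the one word \<open>w @ v\<close> up to sign, so the parity
    of the exponent can be read off.\<close>
  with swap have "cl_proj r s ((-1) ^ ?N v * tmono (w @ v) :: word \<Rightarrow>\<^sub>0 'f) = cl_proj r s (tmono (w @ v))"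
    by (simp add: tmono_append)
  then show ?thesis
    using cl_proj_sign_mono_eq_iff[OF char, of "w @ v" r s "?N v"] ws vs by simp
qed

section \<open>Which monomials are central\<close>

lemma length_filter_greater:
  assumes "distinct w"
  shows "length (filter (\<lambda>i. r < i) w) = card (set w \<inter> {r<..})"
proof -
  have "set (filter (\<lambda>i. r < i) w) = set w \<inter> {r<..}"
    by auto
  with assms show ?thesis by (metis distinct_card distinct_filter)
qed

lemma lie_center_mono_cases:
  assumes char: "CHAR('f::field) \<noteq> 2" and dist: "distinct w" and w: "set w \<subseteq> {1..r + s}"
    and "w \<noteq> []"
    and center: "cl_proj r s (tmono w :: word \<Rightarrow>\<^sub>0 'f) \<in> lie_center (clifford r s) (lie_K r s)"
  shows "set w = {1..r + s} \<and> (r + s) mod 4 = 1 \<and> even s \<or>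
    set w = {r + 1..r + s} \<and> s mod 4 = 2 \<or> set w = {1..r} \<and> r mod 4 = 1"
proof -
  let ?N = "\<lambda>i. length (filter (\<lambda>j. j \<noteq> i) w)"
  have test: "even (\<Sum>i\<leftarrow>v. ?N i)"
    if "distinct v" "set v \<subseteq> {1..r + s}" "length v mod 4 = 1 \<or> length v mod 4 = 2"
      "even (length (filter (\<lambda>i. r < i) v))" for v
    using that mono_mem_lie_K_iff[OF char that(1,2)]
    by (intro mono_mem_lie_center_commute[OF char center _ w]) auto
  have single: "even (?N i)" if "i \<in> {1..r}" for i
    using test[of "[i]"] that by simp
  \<comment> \<open>The word \<open>[i, j]\<close> lies in \<open>lie_K\<close> when i and j are on
    the same side of r. As \<open>?N\<close> is the length of w, less one for indices in w, the sum
    is even only if both or neither occur.\<close>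
  have pair: "i \<in> set w \<longleftrightarrow> j \<in> set w"
    if "i \<in> {1..r + s}" "j \<in> {1..r + s}" "i \<le> r \<longleftrightarrow> j \<le> r" for i j
  proof (cases "i = j")
    case False
    have "even (?N i + ?N j)"
      using test[of "[i, j]"] that False by auto
    moreover have "length w \<noteq> 0"
      using \<open>w \<noteq> []\<close> by simp
    ultimately show ?thesis
      using dist by (auto simp: length_filter_neq split: if_splits)
  qed simp
  have low: "set w \<inter> {1..r} = {} \<or> {1..r} \<subseteq> set w"
    using pair by force
  have high: "set w \<inter> {r + 1..r + s} = {} \<or> {r + 1..r + s} \<subseteq> set w"
  proof (cases "set w \<inter> {r + 1..r + s} = {}")
    case False
    then obtain i where "i \<in> set w" "i \<in> {r + 1..r + s}"
      by blast
    then have "{r + 1..r + s} \<subseteq> set w"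
      using pair[of i] by auto
    then show ?thesis ..
  qed simp
  have k: "length w mod 4 = 1 \<or> length w mod 4 = 2" and even: "even (card (set w \<inter> {r<..}))"
    using center mono_mem_lie_K_iff[OF char dist w] dist
    by (auto simp: lie_center_def length_filter_greater)
  have len: "length w = card (set w)"
    using dist by (simp add: distinct_card)
  have range: "{1..r + s} = {1..r} \<union> {r + 1..r + s}"
    by auto
  \<comment> \<open>The test against e_1 makes \<open>length w - 1\<close> even, which leaves only
    the residue 1 of the two allowed in \<open>lie_K\<close>.\<close>
  have odd: "odd (length w)" if "{1..r} \<subseteq> set w" "r > 0"
  proof -
    have "1 \<in> set w" using that by auto
    then show ?thesis
      using single[of 1] that dist \<open>w \<noteq> []\<close> by (auto simp: length_filter_neq)
  qed
  show ?thesis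
  proof (cases "{r + 1..r + s} \<subseteq> set w")
    case True
    then have "set w \<inter> {r<..} = {r + 1..r + s}"
      using w by auto
    then have s: "even s"
      using even by simp
    show ?thesis
    \<comment> \<open>For r = 0 the lower block is vacuously contained and there is no e_1 to test
      with; the second conjunct sends this case to the alternative where w is the upper
      block.\<close>
    proof (cases "{1..r} \<subseteq> set w \<and> r > 0")
      case True
      then have "set w = {1..r + s}"
        using \<open>{r + 1..r + s} \<subseteq> set w\<close> w range by blast
      moreover from this have "(r + s) mod 4 = 1"
      proof -
        have "length w = r + s" "odd (length w)"
          using odd True len \<open>set w = {1..r + s}\<close> by auto
        then show ?thesis using k by presburger
      qed
      ultimately show ?thesis using s by simp
    next
      case False
      then have "set w = {r + 1..r + s}"
        using low \<open>{r + 1..r + s} \<subseteq> set w\<close> w range by (cases "r = 0") auto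
      moreover from this have "s mod 4 = 2"
        using s k len by auto presburger
      ultimately show ?thesis by simp
    qed
  next
    case False
    then have sub: "set w \<subseteq> {1..r}"
      using high w range by blast
    moreover obtain i where "i \<in> set w"
      using \<open>w \<noteq> []\<close> by (cases w) auto
    ultimately have "i \<in> {1..r}" "set w = {1..r}"
      using low by blast+
    then have "set w = {1..r}" "r > 0"
      by simp_all
    moreover from this have "r mod 4 = 1"
      using odd k len by auto presburger
    ultimately show ?thesis by simp
  qed
qed

theorem proposition4p2:
  fixes r s :: nat and I :: "nat list"
  assumes char: "CHAR('f::field) \<noteq> 2"
    and s_pos: "s > 0"
    and I: "I \<noteq> []" "sorted_wrt (<) I" "set I \<subseteq> {1..r + s}"
  shows "(cl_monomial r s I :: (word \<Rightarrow>\<^sub>0 'f) set) \<in> lie_center (clifford r s) (lie_K r s) \<longleftrightarrow>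
      cl_monomial r s I = (cl_omega r s :: (word \<Rightarrow>\<^sub>0 'f) set) \<and>
        (r + s) mod 4 = 1 \<and> even s
    \<or> set I = {r + 1..r + s} \<and> s mod 4 = 2
    \<or> set I = {1..r} \<and> r mod 4 = 1"
proof -
  let ?C = "lie_center (clifford r s) (lie_K r s) :: (word \<Rightarrow>\<^sub>0 'f) set set"
  have dist: "distinct I"
    using I(2) strict_sorted_iff by blast
  have mono: "cl_monomial r s w = (cl_proj r s (tmono w) :: (word \<Rightarrow>\<^sub>0 'f) set)"
    if "set w \<subseteq> {1..r + s}" for w
    by (rule cl_monomial_eq[OF that])
  have omega: "cl_omega r s = (cl_proj r s (tmono [1..<r + s + 1]) :: (word \<Rightarrow>\<^sub>0 'f) set)"
    unfolding cl_omega_def by (rule mono) auto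
  \<comment> \<open>Stated for arbitrary words, since it is applied both to I and to the word of
    omega.\<close>
  have center: "cl_proj r s (tmono w) \<in> ?C"
    if w: "distinct w" "set w \<subseteq> {1..r + s}" and cases: "set w = {1..r + s} \<and> (r + s) mod 4 = 1 \<and> even s \<or>
        set w = {r + 1..r + s} \<and> s mod 4 = 2 \<or> set w = {1..r} \<and> r mod 4 = 1" for w
  proof (rule mono_mem_lie_center)
    have len: "length w = card (set w)"
      using w by (simp add: distinct_card)
    have "{1..r + s} \<inter> {r<..} = {r + 1..r + s}" "{r + 1..r + s} \<inter> {r<..} = {r + 1..r + s}"
      "{1..r} \<inter> {r<..} = {}"
      by auto
    then show "cl_proj r s (tmono w :: word \<Rightarrow>\<^sub>0 'f) \<in> lie_K r s"
      unfolding mono_mem_lie_K_iff[OF char w] length_filter_greater[OF w(1)] len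
      using cases by (elim disjE conjE) (simp_all, presburger)
    \<comment> \<open>The full set gives r+s-1 for every i, which is even. The upper block gives s
      for i up to r and s-1 beyond; the lower block gives r-1 and r. Both of these are even exactly
      for i up to r, the pattern of beta.\<close>
    show "(\<forall>i\<in>{1..r + s}. even (length (filter (\<lambda>j. j \<noteq> i) w))) \<or>
        (\<forall>i\<in>{1..r + s}. even (length (filter (\<lambda>j. j \<noteq> i) w)) \<longleftrightarrow> i \<le> r)"
      using cases
    proof (elim disjE conjE)
      assume "set w = {1..r + s}" "(r + s) mod 4 = 1"
      moreover from this have "even (r + s - 1)" by presburger
      ultimately show ?thesis by (simp add: length_filter_neq[OF w(1)] len)
    next
      assume "set w = {r + 1..r + s}" "s mod 4 = 2"
      moreover from this have "even s" "odd (s - 1)" by presburger+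
      ultimately show ?thesis by (simp add: length_filter_neq[OF w(1)] len)
    next
      assume "set w = {1..r}" "r mod 4 = 1"
      moreover from this have "odd r" "even (r - 1)" by presburger+
      ultimately show ?thesis by (simp add: length_filter_neq[OF w(1)] len)
    qed
  qed (rule w)
  show ?thesis
  proof
    assume "(cl_monomial r s I :: (word \<Rightarrow>\<^sub>0 'f) set) \<in> ?C"
    then have "set I = {1..r + s} \<and> (r + s) mod 4 = 1 \<and> even s \<or>
        set I = {r + 1..r + s} \<and> s mod 4 = 2 \<or> set I = {1..r} \<and> r mod 4 = 1"
      by (intro lie_center_mono_cases[OF char dist I(3,1)]) (simp only: mono[OF I(3)])
    moreover have "cl_monomial r s I = (cl_omega r s :: (word \<Rightarrow>\<^sub>0 'f) set)" if "set I = {1..r + s}"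
    proof -
      \<comment> \<open>A strictly increasing list is determined by its set of entries.\<close>
      have "I = [1..<r + s + 1]"
      proof (rule sorted_distinct_set_unique[OF strict_sorted_imp_sorted[OF I(2)] dist])
        show "set I = set [1..<r + s + 1]"
          unfolding that by (simp only: set_upt) force
      qed (rule sorted_upt distinct_upt)+
      then show ?thesis by (simp only: cl_omega_def)
    qed
    ultimately show "cl_monomial r s I = (cl_omega r s :: (word \<Rightarrow>\<^sub>0 'f) set) \<and>
        (r + s) mod 4 = 1 \<and> even s
      \<or> set I = {r + 1..r + s} \<and> s mod 4 = 2
      \<or> set I = {1..r} \<and> r mod 4 = 1"
      by blast
  next
    assume *: "cl_monomial r s I = (cl_omega r s :: (word \<Rightarrow>\<^sub>0 'f) set) \<and>
        (r + s) mod 4 = 1 \<and> even s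
      \<or> set I = {r + 1..r + s} \<and> s mod 4 = 2
      \<or> set I = {1..r} \<and> r mod 4 = 1"
    show "(cl_monomial r s I :: (word \<Rightarrow>\<^sub>0 'f) set) \<in> ?C"
    proof (cases "cl_monomial r s I = (cl_omega r s :: (word \<Rightarrow>\<^sub>0 'f) set) \<and>
        (r + s) mod 4 = 1 \<and> even s")
      case True
      moreover have "set [1..<r + s + 1] = {1..r + s}"
        by auto
      ultimately show ?thesis
        using center[of "[1..<r + s + 1]"] omega by simp
    next
      case False
      with * show ?thesis
        unfolding mono[OF I(3)] by (intro center dist I(3)) blast
    qed
  qed
qed

end
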